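(* For integers $m,n$ with $\min(m,n)\ge 3$, the number of vertices of degree $4$ in $\mathrm{OFG}(M_{m,n})$ is \[ 2m^2+2n^2+6mn-10(m+n)-4 . \]
   Context: $G_{m,n}$ is the grid graph with vertex set $\{(i,j): 1\le i\le m,\ 1\le j\le n\}$, each vertex joined to its horizontal and vertical neighbours. A proper $3$-colouring is a map $c:V(G_{m,n})\to\mathbb{Z}/3\mathbb{Z}$ with $c(u)\ne c(v)$ for every edge $uv$. $\mathrm{OFG}(M_{m,n})$ is the origami flip graph of the $m\times n$ Miura-ori (vertices: flat-foldable mountain--valley assignments; edges: single face flips). Throughout it is identified, by a known bijection, with the following simple graph: its vertices are the orbits of proper $3$-colourings of $G_{m,n}$ under the global colour rotation $c\mapsto c+1$ (action of $\mathbb{Z}/3\mathbb{Z}$), and two distinct orbits are adjacent if and only if they contain representatives that differ at exactly one vertex of $G_{m,n}$. *)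

theory Defs
  imports Complex_Main "HOL-Library.FuncSet" "HOL-Library.Numeral_Type"
begin

definition grid_vertices :: "nat \<Rightarrow> nat \<Rightarrow> (nat \<times> nat) set" where
  "grid_vertices m n = {1..m} \<times> {1..n}"

definition grid_adj :: "nat \<Rightarrow> nat \<Rightarrow> nat \<times> nat \<Rightarrow> nat \<times> nat \<Rightarrow> bool" where
  "grid_adj m n u v \<longleftrightarrow>
     u \<in> grid_vertices m n \<and> v \<in> grid_vertices m n \<and>
     ((fst u = fst v \<and> (snd v = snd u + 1 \<or> snd u = snd v + 1)) \<or>
      (snd u = snd v \<and> (fst v = fst u + 1 \<or> fst u = fst v + 1)))"

(* The numeral type 3 is the ring of integers modulo 3. Colourings are extensional
   functions (value undefined off the grid), so that they correspond exactly to maps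
   on the vertex set. *)

definition proper_colourings :: "nat \<Rightarrow> nat \<Rightarrow> (nat \<times> nat \<Rightarrow> 3) set" where
  "proper_colourings m n =
     {c \<in> grid_vertices m n \<rightarrow>\<^sub>E (UNIV :: 3 set). \<forall>u v. grid_adj m n u v \<longrightarrow> c u \<noteq> c v}"

definition rotate_colouring ::
  "nat \<Rightarrow> nat \<Rightarrow> 3 \<Rightarrow> (nat \<times> nat \<Rightarrow> 3) \<Rightarrow> (nat \<times> nat \<Rightarrow> 3)" where
  "rotate_colouring m n k c = (\<lambda>v\<in>grid_vertices m n. c v + k)"

definition colouring_orbit ::
  "nat \<Rightarrow> nat \<Rightarrow> (nat \<times> nat \<Rightarrow> 3) \<Rightarrow> (nat \<times> nat \<Rightarrow> 3) set" where
  "colouring_orbit m n c = {rotate_colouring m n k c | k. True}"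

(* The origami flip graph of the m x n Miura-ori, in its model by 3-colourings of the
   grid graph modulo global colour rotation. *)

definition OFG_vertices :: "nat \<Rightarrow> nat \<Rightarrow> (nat \<times> nat \<Rightarrow> 3) set set" where
  "OFG_vertices m n = colouring_orbit m n ` proper_colourings m n"

definition OFG_adj ::
  "nat \<Rightarrow> nat \<Rightarrow> (nat \<times> nat \<Rightarrow> 3) set \<Rightarrow> (nat \<times> nat \<Rightarrow> 3) set \<Rightarrow> bool" where
  "OFG_adj m n X Y \<longleftrightarrow>
     X \<in> OFG_vertices m n \<and> Y \<in> OFG_vertices m n \<and> X \<noteq> Y \<and>
     (\<exists>c\<in>X. \<exists>d\<in>Y. \<exists>!v. v \<in> grid_vertices m n \<and> c v \<noteq> d v)"

definition OFG_degree :: "nat \<Rightarrow> nat \<Rightarrow> (nat \<times> nat \<Rightarrow> 3) set \<Rightarrow> nat" where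
  "OFG_degree m n X = card {Y. OFG_adj m n X Y}"

end

theory Submission
  imports Defs
begin

text \<open>
  The degree of an orbit is the number of vertices whose neighbours all have the same colour. Lifting
  colour differences to steps +1 and -1 turns a colouring into a height function, the orbits into height
  functions with value 0 at (1, 1), and these vertices into the local extrema. Call a unit square a saddle
  if its two diagonals are level. A discrete Poincare-Hopf count, combined with the observation that in the
  presence of a saddle the height turns at least four times along the boundary, shows that k > 0 saddles
  force at least k + 3 extrema. So degree 4 allows at most one saddle.

  Without saddles the height is a sum f(i) + g(j) of two walks, whose extrema are pairs of minima and pairs of
  maxima; there are four exactly if the numbers of turns of f and g are {0, 2}, or both are 1 with turns of
  opposite type. With one saddle, each of the four quadrants around it must contain exactly one
  extremum, so both walks have constant slope on either side of the saddle. This leaves 4, 8 or 6 colourings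
  according to whether the saddle lies in the interior, at a side or in a corner of the array of squares.
\<close>

section \<open>The index formula for sign fields\<close>

text \<open>The lift to integers exists because every step of a proper colouring is nonzero modulo
  3, and the four signed steps around a unit square have an even sum between -4 and 4 that is
  divisible by 3, hence 0.

  The obstacle is that the plain index count is one short. The steps around the boundary sum to 0,
  so the closed boundary walk always turns at least twice, but two turns only give k + 2 extrema,
  and degree 4 would still admit two saddles. The gain of 1 comes from the two further turns that a
  saddle forces. It confines the classification to fields that are described by two one-dimensional
  walks and the position of at most one saddle, so that everything else is counting on paths. An
  inequality between indices is enough, since the vertices where it is strict only lower the total
  index.\<close>

text \<open>Here x i is the step from vertex i to vertex i + 1 of a path with vertices 1, ..., M; in a sign field,
  b i j is the step from (i, j) to (i + 1, j) and l i j the step from (i, j) to (i, j + 1).\<close>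

definition minima :: "nat \<Rightarrow> (nat \<Rightarrow> int) \<Rightarrow> nat set" where
  "minima M x = {i \<in> {1..M}. (1 < i \<longrightarrow> x (i - 1) = -1) \<and> (i < M \<longrightarrow> x i = 1)}"

definition maxima :: "nat \<Rightarrow> (nat \<Rightarrow> int) \<Rightarrow> nat set" where
  "maxima M x = {i \<in> {1..M}. (1 < i \<longrightarrow> x (i - 1) = 1) \<and> (i < M \<longrightarrow> x i = -1)}"

definition extrema ::
  "nat \<Rightarrow> nat \<Rightarrow> (nat \<Rightarrow> nat \<Rightarrow> int) \<Rightarrow> (nat \<Rightarrow> nat \<Rightarrow> int) \<Rightarrow> (nat \<times> nat) set" where
  "extrema m n b l = {(i, j). i \<in> minima m (\<lambda>i. b i j) \<and> j \<in> minima n (l i) \<or>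
                              i \<in> maxima m (\<lambda>i. b i j) \<and> j \<in> maxima n (l i)}"

text \<open>Comparing horizontal steps suffices: in a sign field the two horizontal steps of a
  square disagree exactly when its two vertical steps do. As steps are 1 or -1, this amounts to both
  diagonals being level.\<close>

definition saddles :: "nat \<Rightarrow> nat \<Rightarrow> (nat \<Rightarrow> nat \<Rightarrow> int) \<Rightarrow> (nat \<times> nat) set" where
  "saddles m n b = {(i, j) \<in> {1..<m} \<times> {1..<n}. b i j \<noteq> b i (j + 1)}"

lemma extrema_subset: "extrema m n b l \<subseteq> {1..m} \<times> {1..n}"
  by (auto simp: extrema_def minima_def maxima_def)

lemma finite_extrema [simp]: "finite (extrema m n b l)"
  by (rule finite_subset[OF extrema_subset]) simp

lemma finite_saddles [simp]: "finite (saddles m n b)"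
  by (rule finite_subset[of _ "{1..<m} \<times> {1..<n}"]) (auto simp: saddles_def)

section \<open>Total variation along a path and summation by parts\<close>

lemma total_variation_ge1:
  fixes u :: "nat \<Rightarrow> int"
  assumes "a \<le> p" "p \<le> c"
  shows "\<bar>u p - u a\<bar> + \<bar>u c - u p\<bar> \<le> (\<Sum>i\<in>{a<..c}. \<bar>u i - u (i - 1)\<bar>)"
proof -
  have tv: "\<bar>u d - u a\<bar> \<le> (\<Sum>i\<in>{a<..d}. \<bar>u i - u (i - 1)\<bar>)" if "a \<le> d" for a d
    using that
  proof (induction d rule: dec_induct)
    case (step k)
    have "{a<..Suc k} = insert (Suc k) {a<..k}" using step by auto
    then show ?case using step by simp
  qed simp
  have "{a<..c} = {a<..p} \<union> {p<..c}" using assms by auto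
  then have "(\<Sum>i\<in>{a<..c}. \<bar>u i - u (i - 1)\<bar>) =
      (\<Sum>i\<in>{a<..p}. \<bar>u i - u (i - 1)\<bar>) + (\<Sum>i\<in>{p<..c}. \<bar>u i - u (i - 1)\<bar>)"
    by (simp add: sum.union_disjoint)
  then show ?thesis using tv[of a p] tv[of p c] assms by linarith
qed

lemma total_variation_ge2:
  fixes u :: "nat \<Rightarrow> int"
  assumes "a \<le> p" "p \<le> q" "q \<le> c"
  shows "\<bar>u p - u a\<bar> + \<bar>u q - u p\<bar> + \<bar>u c - u q\<bar> \<le> (\<Sum>i\<in>{a<..c}. \<bar>u i - u (i - 1)\<bar>)"
proof -
  have "{a<..c} = {a<..p} \<union> {p<..c}" using assms by auto
  then have "(\<Sum>i\<in>{a<..c}. \<bar>u i - u (i - 1)\<bar>) =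
      (\<Sum>i\<in>{a<..p}. \<bar>u i - u (i - 1)\<bar>) + (\<Sum>i\<in>{p<..c}. \<bar>u i - u (i - 1)\<bar>)"
    by (simp add: sum.union_disjoint)
  then show ?thesis
    using total_variation_ge1[of a a p u] total_variation_ge1[of p q c u] assms by simp
qed

lemma sum_shift_product:
  fixes u v :: "nat \<Rightarrow> int"
  assumes "u 0 = 0"
  shows "(\<Sum>i\<in>{1..M}. u (i - 1) * v i) = (\<Sum>i\<in>{1..<M}. u i * v (i + 1))"
proof (induction M)
  case (Suc M)
  show ?case
  proof (cases "M = 0")
    case False
    then have "{1..<Suc M} = insert M {1..<M}" by auto
    then show ?thesis using Suc by simp
  qed (simp add: assms)
qed simp

lemma sum_drop_last:
  fixes w :: "nat \<Rightarrow> int"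
  assumes "w M = 0"
  shows "(\<Sum>i\<in>{1..M}. w i) = (\<Sum>i\<in>{1..<M}. w i)"
proof (cases "M = 0")
  case False
  then have "{1..M} = insert M {1..<M}" by auto
  then show ?thesis using assms by simp
qed simp

text \<open>Abel summation in each direction exchanges the directions of the two differences, and
  the zero values on the four sides kill the boundary terms. A sum over vertices thereby becomes a
  sum over unit squares, where it can be evaluated.\<close>

lemma sum_by_parts_grid:
  fixes B L :: "nat \<Rightarrow> nat \<Rightarrow> int"
  assumes "\<And>j. B 0 j = 0" "\<And>j. B m j = 0" "\<And>i. L i 0 = 0" "\<And>i. L i n = 0"
  shows "(\<Sum>i\<in>{1..m}. \<Sum>j\<in>{1..n}. (B i j - B (i - 1) j) * (L i j - L i (j - 1))) =
         (\<Sum>i\<in>{1..<m}. \<Sum>j\<in>{1..<n}. (B i j - B i (j + 1)) * (L i j - L (i + 1) j))"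
proof -
  have col: "(\<Sum>j\<in>{1..n}. D j * (L i j - L i (j - 1))) = (\<Sum>j\<in>{1..<n}. (D j - D (j + 1)) * L i j)"
    for D :: "nat \<Rightarrow> int" and i
  proof -
    have "(\<Sum>j\<in>{1..n}. D j * (L i j - L i (j - 1))) =
        (\<Sum>j\<in>{1..n}. D j * L i j) - (\<Sum>j\<in>{1..n}. L i (j - 1) * D j)"
      by (simp add: algebra_simps sum_subtractf)
    also have "\<dots> = (\<Sum>j\<in>{1..<n}. D j * L i j) - (\<Sum>j\<in>{1..<n}. L i j * D (j + 1))"
      by (subst sum_shift_product, simp add: assms, subst sum_drop_last, simp_all add: assms)
    finally show ?thesis by (simp add: algebra_simps sum_subtractf)
  qed
  define E where "E = (\<lambda>i j. B i j - B i (j + 1))"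
  have "(\<Sum>i\<in>{1..m}. \<Sum>j\<in>{1..n}. (B i j - B (i - 1) j) * (L i j - L i (j - 1))) =
        (\<Sum>i\<in>{1..m}. \<Sum>j\<in>{1..<n}. (E i j - E (i - 1) j) * L i j)"
  proof (rule sum.cong[OF refl])
    fix i
    show "(\<Sum>j\<in>{1..n}. (B i j - B (i - 1) j) * (L i j - L i (j - 1))) =
          (\<Sum>j\<in>{1..<n}. (E i j - E (i - 1) j) * L i j)"
      using col[of "\<lambda>j. B i j - B (i - 1) j" i] by (simp add: E_def algebra_simps)
  qed
  also have "\<dots> = (\<Sum>j\<in>{1..<n}. \<Sum>i\<in>{1..m}. (E i j - E (i - 1) j) * L i j)"
    by (rule sum.swap)
  also have "\<dots> = (\<Sum>j\<in>{1..<n}. \<Sum>i\<in>{1..<m}. E i j * (L i j - L (i + 1) j))"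
  proof (rule sum.cong[OF refl])
    fix j
    have "(\<Sum>i\<in>{1..m}. (E i j - E (i - 1) j) * L i j) =
        (\<Sum>i\<in>{1..m}. E i j * L i j) - (\<Sum>i\<in>{1..m}. E (i - 1) j * L i j)"
      by (simp add: algebra_simps sum_subtractf)
    also have "\<dots> = (\<Sum>i\<in>{1..<m}. E i j * L i j) - (\<Sum>i\<in>{1..<m}. E i j * L (i + 1) j)"
      using sum_shift_product[of "\<lambda>i. E i j" "\<lambda>i. L i j" m] sum_drop_last[of "\<lambda>i. E i j * L i j" m]
      by (simp add: E_def assms)
    finally show "(\<Sum>i\<in>{1..m}. (E i j - E (i - 1) j) * L i j) = (\<Sum>i\<in>{1..<m}. E i j * (L i j - L (i + 1) j))"
      by (simp add: algebra_simps sum_subtractf)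
  qed
  also have "\<dots> = (\<Sum>i\<in>{1..<m}. \<Sum>j\<in>{1..<n}. E i j * (L i j - L (i + 1) j))"
    by (rule sum.swap)
  finally show ?thesis by (simp add: E_def)
qed

text \<open>Path independence around each unit square, expressed by \<open>quad\<close>, makes the
  steps the increments of a height function.\<close>

locale sign_field =
  fixes m n :: nat and b l :: "nat \<Rightarrow> nat \<Rightarrow> int"
  assumes m2: "2 \<le> m" and n2: "2 \<le> n"
    and b_sign: "\<And>i j. i \<in> {1..<m} \<Longrightarrow> j \<in> {1..n} \<Longrightarrow> b i j \<in> {1, -1}"
    and l_sign: "\<And>i j. i \<in> {1..m} \<Longrightarrow> j \<in> {1..<n} \<Longrightarrow> l i j \<in> {1, -1}"
    and quad: "\<And>i j. i \<in> {1..<m} \<Longrightarrow> j \<in> {1..<n} \<Longrightarrow> b i j + l (i + 1) j = l i j + b i (j + 1)"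
begin

abbreviation "Ext \<equiv> extrema m n b l"
abbreviation "Sad \<equiv> saddles m n b"

text \<open>If the horizontal steps of a square are opposite, \<open>quad\<close> makes its vertical
  steps differ by \<open>2 * b i j\<close>, which leaves one sign pattern up to a global
  sign.\<close>

lemma saddle_signs:
  assumes "(i, j) \<in> Sad"
  shows "l i j = b i j" "b i (j + 1) = - b i j" "l (i + 1) j = - b i j"
  using assms b_sign[of i j] b_sign[of i "j + 1"] l_sign[of i j] l_sign[of "i + 1" j] quad[of i j]
  by (auto simp: saddles_def)

lemma not_saddle:
  assumes "i \<in> {1..<m}" "j \<in> {1..<n}" "(i, j) \<notin> Sad"
  shows "b i (j + 1) = b i j" "l (i + 1) j = l i j"
  using assms quad[of i j] by (auto simp: saddles_def)

text \<open>The device that carries signs at a saddle to the boundary, where they can be compared: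
  only a saddle reverses a step that is moved across a square.\<close>

lemma b_const:
  assumes "i \<in> {1..<m}" "1 \<le> j" "j \<le> j'" "j' \<le> n" "\<And>k. k \<in> {j..<j'} \<Longrightarrow> (i, k) \<notin> Sad"
  shows "b i j' = b i j"
  using assms(3,4,5)
proof (induction j' rule: dec_induct)
  case (step k)
  have "(i, k) \<notin> Sad" "k < n" using step by auto
  then have "b i (Suc k) = b i k" using not_saddle(1)[of i k] assms step by auto
  then show ?case using step by simp
qed simp

lemma l_const:
  assumes "j \<in> {1..<n}" "1 \<le> i" "i \<le> i'" "i' \<le> m" "\<And>k. k \<in> {i..<i'} \<Longrightarrow> (k, j) \<notin> Sad"
  shows "l i' j = l i j"
  using assms(3,4,5)
proof (induction i' rule: dec_induct)
  case (step k)
  have "(k, j) \<notin> Sad" "k < m" using step by auto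
  then have "l (Suc k) j = l k j" using not_saddle(2)[of k j] assms step by auto
  then show ?case using step by simp
qed simp

definition "variation_bottom = (\<Sum>i\<in>{1<..m - 1}. \<bar>b i 1 - b (i - 1) 1\<bar>)"
definition "variation_top = (\<Sum>i\<in>{1<..m - 1}. \<bar>b i n - b (i - 1) n\<bar>)"
definition "variation_left = (\<Sum>j\<in>{1<..n - 1}. \<bar>l 1 j - l 1 (j - 1)\<bar>)"
definition "variation_right = (\<Sum>j\<in>{1<..n - 1}. \<bar>l m j - l m (j - 1)\<bar>)"
text \<open>The walk follows the steps along the bottom and the right side and runs against them
  along the top and the left side, where its steps are \<open>- b i n\<close> and
  \<open>- l 1 j\<close>. This explains the plus signs at \<open>(1, 1)\<close> and
  \<open>(m, n)\<close>, where the orientation changes. Each turn contributes 2.\<close>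

definition "variation_corners =
  \<bar>b 1 1 + l 1 1\<bar> + \<bar>b (m - 1) 1 - l m 1\<bar> + \<bar>l m (n - 1) + b (m - 1) n\<bar> + \<bar>b 1 n - l 1 (n - 1)\<bar>"
definition "boundary_variation =
  variation_bottom + variation_top + variation_left + variation_right + variation_corners"

text \<open>Walk once around the boundary. Seen from the lowest row of saddles, its leftmost and rightmost saddles
  determine the signs of two side steps and of two bottom steps; together with the leftmost saddle of the
  topmost row they yield four boundary steps of alternating sign.\<close>

lemma boundary_variation_ge:
  assumes "Sad \<noteq> {}"
  shows "8 \<le> boundary_variation"
proof -
  define q where "q = Min (snd ` Sad)"
  define q' where "q' = Max (snd ` Sad)"
  have q: "q \<in> snd ` Sad" "\<And>i j. (i, j) \<in> Sad \<Longrightarrow> q \<le> j"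
    unfolding q_def using assms Min_in[of "snd ` Sad"] by (simp, force intro: Min_le)
  have q': "q' \<in> snd ` Sad" "\<And>i j. (i, j) \<in> Sad \<Longrightarrow> j \<le> q'"
    unfolding q'_def using assms Max_in[of "snd ` Sad"] by (simp, force intro: Max_ge)
  define R where "R j = {i. (i, j) \<in> Sad}" for j
  have finR: "finite (R j)" for j
    by (rule finite_subset[of _ "fst ` Sad"]) (force simp: R_def image_iff)+
  have ne: "R q \<noteq> {}" "R q' \<noteq> {}" using q(1) q'(1) by (auto simp: R_def)
  define a where "a = Min (R q)"
  define z where "z = Max (R q)"
  define a' where "a' = Min (R q')"
  have a: "(a, q) \<in> Sad" "\<And>i. (i, q) \<in> Sad \<Longrightarrow> a \<le> i"
    using Min_in[OF finR ne(1)] Min_le[OF finR] unfolding a_def by (auto simp: R_def)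
  have z: "(z, q) \<in> Sad" "\<And>i. (i, q) \<in> Sad \<Longrightarrow> i \<le> z"
    using Max_in[OF finR ne(1)] Max_ge[OF finR] unfolding z_def by (auto simp: R_def)
  have a': "(a', q') \<in> Sad" "\<And>i. (i, q') \<in> Sad \<Longrightarrow> a' \<le> i"
    using Min_in[OF finR ne(2)] Min_le[OF finR] unfolding a'_def by (auto simp: R_def)
  have rng: "a \<in> {1..<m}" "z \<in> {1..<m}" "a' \<in> {1..<m}" "q \<in> {1..<n}" "q' \<in> {1..<n}"
    using a(1) z(1) a'(1) by (auto simp: saddles_def)
  have az: "a \<le> z" and qq: "q \<le> q'" using a z q a' by auto
  define s where "s = l 1 q"
  have s: "s \<in> {1, -1}" using l_sign[of 1 q] rng m2 by (auto simp: s_def)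
  have la: "l a q = s"
    unfolding s_def by (rule l_const) (use rng a(2) in \<open>force+\<close>)
  \<comment> \<open>No saddle lies in a row below \<open>q\<close>, so the horizontal steps of row
    \<open>q\<close> can be read off at the bottom. Above \<open>q'\<close> the same holds for the
    top.\<close>
  have low: "b i q = b i 1" if "i \<in> {1..<m}" for i
    by (rule b_const) (use that rng q(2) in \<open>force+\<close>)
  have ba: "b a 1 = s" using saddle_signs(1)[OF a(1)] la low rng by simp
  have lz: "l m q = l (z + 1) q"
    by (rule l_const) (use rng z(2) in \<open>force+\<close>)
  have bz: "b z 1 = - l m q" using saddle_signs(3)[OF z(1)] lz low rng by simp
  have la': "l a' q' = l 1 q'"
    by (rule l_const) (use rng a'(2) in \<open>force+\<close>)
  have top: "b a' n = b a' (q' + 1)"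
    by (rule b_const) (use rng q'(2) in \<open>force+\<close>)
  have ba': "b a' n = - l 1 q'" using saddle_signs[OF a'(1)] la' top by simp
  have lm: "l m q = s \<or> l m q = -s" using l_sign[of m q] rng m2 s by auto
  have l1: "l 1 q' = s \<or> l 1 q' = -s" using l_sign[of 1 q'] rng m2 s by auto
  note tvb = total_variation_ge2[of 1 a z "m - 1" "\<lambda>i. b i 1", folded variation_bottom_def]
  note tvt = total_variation_ge1[of 1 a' "m - 1" "\<lambda>i. b i n", folded variation_top_def]
  note tvr = total_variation_ge1[of 1 q "n - 1" "\<lambda>j. l m j", folded variation_right_def]
  note tvl = total_variation_ge2[of 1 q q' "n - 1" "\<lambda>j. l 1 j", folded variation_left_def]
  have c: "1 \<le> a" "z \<le> m - 1" "1 \<le> a'" "a' \<le> m - 1" "1 \<le> q" "q \<le> n - 1" "q' \<le> n - 1"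
    using rng by auto
  note tv = tvb[OF c(1) az c(2)] tvt[OF c(3,4)] tvr[OF c(5,6)] tvl[OF c(5) qq c(7)]
  \<comment> \<open>One triangle inequality per corner of the grid: it absorbs the corner term
    together with the adjacent end pieces of the two sides.\<close>
  have "\<bar>l m q - b z 1\<bar> \<le> \<bar>b (m - 1) 1 - b z 1\<bar> + \<bar>b (m - 1) 1 - l m 1\<bar> + \<bar>l m q - l m 1\<bar>"
    "\<bar>l m q + b a' n\<bar> \<le> \<bar>l m (n - 1) - l m q\<bar> + \<bar>l m (n - 1) + b (m - 1) n\<bar> + \<bar>b (m - 1) n - b a' n\<bar>"
    "\<bar>b a' n - l 1 q'\<bar> \<le> \<bar>b a' n - b 1 n\<bar> + \<bar>b 1 n - l 1 (n - 1)\<bar> + \<bar>l 1 (n - 1) - l 1 q'\<bar>"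
    "\<bar>l 1 q + b a 1\<bar> \<le> \<bar>l 1 q - l 1 1\<bar> + \<bar>b 1 1 + l 1 1\<bar> + \<bar>b a 1 - b 1 1\<bar>"
    by linarith+
  then have "\<bar>l m q - b z 1\<bar> + \<bar>l m q + b a' n\<bar> + \<bar>b a' n - l 1 q'\<bar> + \<bar>l 1 q + b a 1\<bar>
      + \<bar>b z 1 - b a 1\<bar> + \<bar>l 1 q' - l 1 q\<bar> \<le> boundary_variation"
    using tv unfolding boundary_variation_def variation_corners_def by linarith
  \<comment> \<open>Write r for \<open>l m q\<close> and t for \<open>l 1 q'\<close>. In the order
    of the walk the signs are s, -r, r, t, -t, -s. Three of the changes between cyclic neighbours
    equal 2, and \<bar>s + r\<bar> + \<bar>r - t\<bar> + \<bar>t - s\<bar> is at least 2, since for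
    r = -s the sign t cannot equal both r and s.\<close>
  then show ?thesis
    using s lm l1 unfolding ba bz ba' s_def[symmetric] by auto
qed

section \<open>The discrete Poincare-Hopf count\<close>

lemma sum_grid_row:
  fixes f :: "nat \<Rightarrow> int"
  assumes "finite A" "finite B" "y \<in> B" "S \<subseteq> A"
  shows "(\<Sum>i\<in>A. \<Sum>j\<in>B. if j = y \<and> i \<in> S then f i else 0) = sum f S"
proof -
  have "(\<Sum>j\<in>B. if j = y \<and> i \<in> S then f i else 0) = (if i \<in> S then f i else 0)" for i
    using assms sum.delta[of B y "\<lambda>_. f i"] by (cases "i \<in> S") simp_all
  moreover have "A \<inter> S = S" using assms by auto
  ultimately show ?thesis
    using assms sum.inter_restrict[of A f S] by simp
qed

lemma sum_grid_column:
  fixes f :: "nat \<Rightarrow> int"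
  assumes "finite A" "finite B" "x \<in> A" "S \<subseteq> B"
  shows "(\<Sum>i\<in>A. \<Sum>j\<in>B. if i = x \<and> j \<in> S then f j else 0) = sum f S"
  by (subst sum.swap) (rule sum_grid_row[OF assms(2,1,3,4)])

text \<open>Extending the steps by 0 outside the grid, the index of a vertex is a product of two second differences,
  and summation by parts turns the total index into four times the number of saddles. The terms V account
  for the turns of the boundary walk.\<close>

lemma card_saddles_extrema:
  assumes "Sad \<noteq> {}"
  shows "card Sad + 3 \<le> card Ext"
proof -
  define B where "B = (\<lambda>i j. if 1 \<le> i \<and> i < m then b i j else 0)"
  define L where "L = (\<lambda>i j. if 1 \<le> j \<and> j < n then l i j else 0)"
  define T where "T = (\<lambda>i j. (B i j - B (i - 1) j) * (L i j - L i (j - 1)))"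
  define V1 where "V1 = (\<lambda>(i::nat) (j::nat). if j = 1 \<and> i \<in> {1<..m - 1} then \<bar>b i 1 - b (i - 1) 1\<bar> else 0)"
  define V2 where "V2 = (\<lambda>(i::nat) (j::nat). if j = n \<and> i \<in> {1<..m - 1} then \<bar>b i n - b (i - 1) n\<bar> else 0)"
  define V3 where "V3 = (\<lambda>(i::nat) (j::nat). if i = 1 \<and> j \<in> {1<..n - 1} then \<bar>l 1 j - l 1 (j - 1)\<bar> else 0)"
  define V4 where "V4 = (\<lambda>(i::nat) (j::nat). if i = m \<and> j \<in> {1<..n - 1} then \<bar>l m j - l m (j - 1)\<bar> else 0)"
  \<comment> \<open>The extra 1 balances the index at a corner, which is 1 if the corner is extremal
    and -1 otherwise: together with the turn this gives 4 or 0. The four corners account for the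
    summand 4 in \<open>sumV\<close>.\<close>
  define V5 where "V5 = (\<lambda>(i::nat) (j::nat). if j = 1 \<and> i \<in> {1} then 1 + \<bar>b 1 1 + l 1 1\<bar> else 0)"
  define V6 where "V6 = (\<lambda>(i::nat) (j::nat). if j = 1 \<and> i \<in> {m} then 1 + \<bar>b (m - 1) 1 - l m 1\<bar> else 0)"
  define V7 where "V7 = (\<lambda>(i::nat) (j::nat). if j = n \<and> i \<in> {m} then 1 + \<bar>l m (n - 1) + b (m - 1) n\<bar> else 0)"
  define V8 where "V8 = (\<lambda>(i::nat) (j::nat). if j = n \<and> i \<in> {1} then 1 + \<bar>b 1 n - l 1 (n - 1)\<bar> else 0)"
  define V where "V = (\<lambda>(i::nat) (j::nat). V1 i j + V2 i j + V3 i j + V4 i j + V5 i j + V6 i j + V7 i j + V8 i j)"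
  note Vs = V1_def V2_def V3_def V4_def V5_def V6_def V7_def V8_def
  \<comment> \<open>Equality holds except at interior vertices that are minimal in one direction and
    maximal in the other, where the left side is -4.\<close>
  have pw: "T i j + V i j \<le> 4 * of_bool ((i, j) \<in> Ext)" if ij: "i \<in> {1..m}" "j \<in> {1..n}" for i j
  proof -
    have be: "i < m \<Longrightarrow> b i j = 1 \<or> b i j = -1" and lu: "j < n \<Longrightarrow> l i j = 1 \<or> l i j = -1"
      using ij b_sign[of i j] l_sign[of i j] by auto
    have "1 < i \<Longrightarrow> i - 1 \<in> {1..<m}" "1 < j \<Longrightarrow> j - 1 \<in> {1..<n}" using ij by auto
    then have bw: "1 < i \<Longrightarrow> b (i - 1) j = 1 \<or> b (i - 1) j = -1"
      and ld: "1 < j \<Longrightarrow> l i (j - 1) = 1 \<or> l i (j - 1) = -1"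
      using ij b_sign[of "i - 1" j] l_sign[of i "j - 1"] by blast+
    \<comment> \<open>These are the rises from the vertex to its east, west, upper and lower
      neighbour, with 0 for a missing one. As 0 satisfies both \<le> 0 and \<ge> 0, a missing
      neighbour imposes no condition in \<open>ext\<close>.\<close>
    define e where "e = B i j"
    define w where "w = - B (i - 1) j"
    define u where "u = L i j"
    define d where "d = - L i (j - 1)"
    have sgn_e: "e = 0 \<and> i = m \<or> (e = 1 \<or> e = -1) \<and> i < m"
      using ij be by (cases "i < m") (auto simp: e_def B_def)
    have sgn_w: "w = 0 \<and> i = 1 \<or> (w = 1 \<or> w = -1) \<and> 1 < i"
      using ij bw by (cases "1 < i") (auto simp: w_def B_def)
    have sgn_u: "u = 0 \<and> j = n \<or> (u = 1 \<or> u = -1) \<and> j < n"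
      using ij lu by (cases "j < n") (auto simp: u_def L_def)
    have sgn_d: "d = 0 \<and> j = 1 \<or> (d = 1 \<or> d = -1) \<and> 1 < j"
      using ij ld by (cases "1 < j") (auto simp: d_def L_def)
    note sgn = sgn_e sgn_w sgn_u sgn_d
    have ext: "(i, j) \<in> Ext \<longleftrightarrow> 0 \<le> e \<and> 0 \<le> w \<and> 0 \<le> u \<and> 0 \<le> d \<or> e \<le> 0 \<and> w \<le> 0 \<and> u \<le> 0 \<and> d \<le> 0"
    proof -
      have "i \<in> minima m (\<lambda>i. b i j) \<longleftrightarrow> 0 \<le> e \<and> 0 \<le> w" "i \<in> maxima m (\<lambda>i. b i j) \<longleftrightarrow> e \<le> 0 \<and> w \<le> 0"
        using ij be bw by (auto simp: e_def w_def B_def minima_def maxima_def)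
      moreover have "j \<in> minima n (l i) \<longleftrightarrow> 0 \<le> u \<and> 0 \<le> d" "j \<in> maxima n (l i) \<longleftrightarrow> u \<le> 0 \<and> d \<le> 0"
        using ij lu ld by (auto simp: u_def d_def L_def minima_def maxima_def)
      ultimately show ?thesis by (auto simp: extrema_def)
    qed
    have V: "V i j = (if (i = 1 \<or> i = m) \<and> (j = 1 \<or> j = n) then 1 + \<bar>e + w + u + d\<bar>
        else if j = 1 \<or> j = n then \<bar>e + w\<bar> else if i = 1 \<or> i = m then \<bar>u + d\<bar> else 0)"
    proof -
      have ewud: "e = (if i = m then 0 else b i j)" "w = (if i = 1 then 0 else - b (i - 1) j)"
        "u = (if j = n then 0 else l i j)" "d = (if j = 1 then 0 else - l i (j - 1))"
        using ij by (auto simp: e_def w_def u_def d_def B_def L_def)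
      have rng: "i \<in> {1<..m - 1} \<longleftrightarrow> i \<noteq> 1 \<and> i \<noteq> m" "j \<in> {1<..n - 1} \<longleftrightarrow> j \<noteq> 1 \<and> j \<noteq> n"
        using ij by auto
      have mn: "m \<noteq> 1" "n \<noteq> 1" using m2 n2 by auto
      show ?thesis
        unfolding V_def Vs ewud rng
        by (cases "i = 1"; cases "i = m"; cases "j = 1"; cases "j = n"; use mn in \<open>simp; linarith?\<close>)
    qed
    have T: "T i j = (e + w) * (u + d)" by (simp add: T_def e_def w_def u_def d_def)
    show ?thesis
      unfolding T V ext using sgn m2 n2 by (elim disjE conjE) simp_all
  qed
  have sumV: "(\<Sum>i\<in>{1..m}. \<Sum>j\<in>{1..n}. V i j) = boundary_variation + 4"
  proof -
    have "(\<Sum>i\<in>{1..m}. \<Sum>j\<in>{1..n}. V1 i j) = variation_bottom"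
      unfolding V1_def variation_bottom_def using m2 n2 by (intro sum_grid_row) auto
    moreover have "(\<Sum>i\<in>{1..m}. \<Sum>j\<in>{1..n}. V2 i j) = variation_top"
      unfolding V2_def variation_top_def using m2 n2 by (intro sum_grid_row) auto
    moreover have "(\<Sum>i\<in>{1..m}. \<Sum>j\<in>{1..n}. V3 i j) = variation_left"
      unfolding V3_def variation_left_def using m2 n2 by (intro sum_grid_column) auto
    moreover have "(\<Sum>i\<in>{1..m}. \<Sum>j\<in>{1..n}. V4 i j) = variation_right"
      unfolding V4_def variation_right_def using m2 n2 by (intro sum_grid_column) auto
    moreover have "(\<Sum>i\<in>{1..m}. \<Sum>j\<in>{1..n}. V5 i j) = 1 + \<bar>b 1 1 + l 1 1\<bar>"
      unfolding V5_def using m2 n2 by (subst sum_grid_row) auto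
    moreover have "(\<Sum>i\<in>{1..m}. \<Sum>j\<in>{1..n}. V6 i j) = 1 + \<bar>b (m - 1) 1 - l m 1\<bar>"
      unfolding V6_def using m2 n2 by (subst sum_grid_row) auto
    moreover have "(\<Sum>i\<in>{1..m}. \<Sum>j\<in>{1..n}. V7 i j) = 1 + \<bar>l m (n - 1) + b (m - 1) n\<bar>"
      unfolding V7_def using m2 n2 by (subst sum_grid_row) auto
    moreover have "(\<Sum>i\<in>{1..m}. \<Sum>j\<in>{1..n}. V8 i j) = 1 + \<bar>b 1 n - l 1 (n - 1)\<bar>"
      unfolding V8_def using m2 n2 by (subst sum_grid_row) auto
    ultimately show ?thesis
      by (simp only: V_def sum.distrib boundary_variation_def variation_corners_def)
  qed
  have card_of_bool: "int (card S) = (\<Sum>i\<in>A. \<Sum>j\<in>C. of_bool ((i, j) \<in> S))"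
    if "S \<subseteq> A \<times> C" "finite A" "finite C" for S and A C :: "nat set"
  proof -
    have "(A \<times> C) \<inter> S = S" using that by auto
    then have "int (card S) = (\<Sum>z\<in>A \<times> C. of_bool (z \<in> S))" using that by (simp add: Int_def)
    also have "\<dots> = (\<Sum>i\<in>A. \<Sum>j\<in>C. of_bool ((i, j) \<in> S))"
      unfolding sum.cartesian_product by (rule sum.cong) auto
    finally show ?thesis .
  qed
  have "(\<Sum>i\<in>{1..m}. \<Sum>j\<in>{1..n}. T i j) =
        (\<Sum>i\<in>{1..<m}. \<Sum>j\<in>{1..<n}. (B i j - B i (j + 1)) * (L i j - L (i + 1) j))"
    unfolding T_def by (rule sum_by_parts_grid) (auto simp: B_def L_def)
  \<comment> \<open>At a saddle both differences equal \<open>2 * b i j\<close> by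
    \<open>saddle_signs\<close>; at any other square the first one vanishes.\<close>
  also have "\<dots> = (\<Sum>i\<in>{1..<m}. \<Sum>j\<in>{1..<n}. 4 * of_bool ((i, j) \<in> Sad))"
  proof (intro sum.cong refl)
    fix i j assume ij: "i \<in> {1..<m}" "j \<in> {1..<n}"
    show "(B i j - B i (j + 1)) * (L i j - L (i + 1) j) = 4 * of_bool ((i, j) \<in> Sad)"
    proof (cases "(i, j) \<in> Sad")
      case True
      then show ?thesis using saddle_signs[OF True] ij b_sign[of i j] by (auto simp: B_def L_def)
    next
      case False
      then show ?thesis using not_saddle[OF ij False] ij by (simp add: B_def)
    qed
  qed
  also have "\<dots> = 4 * int (card Sad)"
  proof -
    have "Sad \<subseteq> {1..<m} \<times> {1..<n}" by (auto simp: saddles_def)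
    from card_of_bool[OF this finite_atLeastLessThan finite_atLeastLessThan] show ?thesis
      by (simp only: sum_distrib_left[symmetric])
  qed
  finally have sumT: "(\<Sum>i\<in>{1..m}. \<Sum>j\<in>{1..n}. T i j) = 4 * int (card Sad)" .
  have "(\<Sum>i\<in>{1..m}. \<Sum>j\<in>{1..n}. T i j + V i j) \<le>
        (\<Sum>i\<in>{1..m}. \<Sum>j\<in>{1..n}. 4 * of_bool ((i, j) \<in> Ext))"
    by (intro sum_mono pw)
  then have "4 * int (card Sad) + (boundary_variation + 4) \<le> 4 * int (card Ext)"
    unfolding card_of_bool[OF extrema_subset finite_atLeastAtMost finite_atLeastAtMost]
      sum.distrib sumT sumV sum_distrib_left .
  then show ?thesis using boundary_variation_ge[OF assms] by linarith
qed

end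

section \<open>Sign sequences\<close>

definition sign_sequences :: "nat \<Rightarrow> (nat \<Rightarrow> int) set" where
  "sign_sequences M = {1..<M} \<rightarrow>\<^sub>E {1, -1}"

definition turns :: "nat \<Rightarrow> (nat \<Rightarrow> int) \<Rightarrow> nat set" where
  "turns M x = {i \<in> {2..<M}. x (i - 1) \<noteq> x i}"

lemma finite_sign_sequences [simp]: "finite (sign_sequences M)"
  by (simp add: sign_sequences_def finite_PiE)

lemma sign_sequencesD: "x \<in> sign_sequences M \<Longrightarrow> i \<in> {1..<M} \<Longrightarrow> x i = 1 \<or> x i = -1"
  by (auto simp: sign_sequences_def PiE_iff)

lemma finite_turns [simp]: "finite (turns M x)"
  by (simp add: turns_def)

lemma finite_minima [simp]: "finite (minima M x)" and finite_maxima [simp]: "finite (maxima M x)"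
  by (simp_all add: minima_def maxima_def)

lemma turns_Suc:
  "turns (Suc M) x = (if 2 \<le> M \<and> x (M - 1) \<noteq> x M then insert M (turns M x) else turns M x)"
  by (auto simp: turns_def less_Suc_eq)

lemma sign_sequences_image: "x \<in> sign_sequences M \<Longrightarrow> x ` {1..<M} \<subseteq> {1, -1}"
  using sign_sequencesD by blast

lemma sign_cases: "x ` {1..<M} \<subseteq> {1, -1 :: int} \<Longrightarrow> i \<in> {1..<M} \<Longrightarrow> x i = 1 \<or> x i = -1"
  by blast

lemma sign_from_turns:
  assumes "x ` {1..<M} \<subseteq> {1, -1 :: int}" "i \<in> {1..<M}"
  shows "x i = x 1 * (-1) ^ card (turns (Suc i) x)"
  using assms(2)
proof (induction i)
  case (Suc i)
  show ?case
  proof (cases "i = 0")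
    case True
    then show ?thesis by (simp add: turns_def)
  next
    case False
    then have IH: "x i = x 1 * (-1) ^ card (turns (Suc i) x)" using Suc by auto
    have "Suc i \<notin> turns (Suc i) x" by (simp add: turns_def)
    moreover have "x i = 1 \<or> x i = -1" "x (Suc i) = 1 \<or> x (Suc i) = -1"
      using sign_cases[OF assms(1), of i] sign_cases[OF assms(1), of "Suc i"] Suc False by auto
    ultimately show ?thesis using IH False by (subst turns_Suc) auto
  qed
qed simp

lemma minima_maxima_disjoint: "2 \<le> M \<Longrightarrow> minima M x \<inter> maxima M x = {}"
  by (fastforce simp: minima_def maxima_def)

lemma minima_Un_maxima:
  assumes "2 \<le> M" "x ` {1..<M} \<subseteq> {1, -1 :: int}"
  shows "minima M x \<union> maxima M x = {1, M} \<union> turns M x"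
proof (rule set_eqI)
  fix i
  show "i \<in> minima M x \<union> maxima M x \<longleftrightarrow> i \<in> {1, M} \<union> turns M x"
  proof (cases "i \<in> {1..M}")
    case True
    then have "i \<noteq> M \<Longrightarrow> i \<in> {1..<M}" "i \<noteq> 1 \<Longrightarrow> i - 1 \<in> {1..<M}" by auto
    then have "i \<noteq> M \<Longrightarrow> x i = 1 \<or> x i = -1" "i \<noteq> 1 \<Longrightarrow> x (i - 1) = 1 \<or> x (i - 1) = -1"
      using sign_cases[OF assms(2)] by blast+
    moreover have "1 < i \<longleftrightarrow> i \<noteq> 1" "i < M \<longleftrightarrow> i \<noteq> M" "i \<in> {2..<M} \<longleftrightarrow> i \<noteq> 1 \<and> i \<noteq> M" "M \<noteq> 1"
      using True assms(1) by auto
    ultimately show ?thesis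
      using True unfolding minima_def maxima_def turns_def Un_iff mem_Collect_eq
      by (cases "i = 1"; cases "i = M") auto
  next
    case False
    then show ?thesis using assms(1) by (auto simp: minima_def maxima_def turns_def)
  qed
qed

lemma card_extrema_sum:
  assumes "2 \<le> M" "x ` {1..<M} \<subseteq> {1, -1 :: int}"
  shows "card (minima M x) + card (maxima M x) = card (turns M x) + 2"
proof -
  have "card (minima M x) + card (maxima M x) = card (minima M x \<union> maxima M x)"
    using minima_maxima_disjoint[OF assms(1)] by (simp add: card_Un_disjoint)
  also have "\<dots> = card (insert 1 (insert M (turns M x)))"
    using minima_Un_maxima[OF assms] by (simp only: Un_insert_left Un_empty_left)
  also have "\<dots> = card (turns M x) + 2"
    using assms(1) by (auto simp: turns_def card_insert_if)
  finally show ?thesis .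
qed

lemma sum_of_bool_set: "(S :: nat set) \<subseteq> {1..M} \<Longrightarrow> int (card S) = (\<Sum>i\<in>{1..M}. of_bool (i \<in> S))"
  by (simp add: Int_absorb1)

text \<open>Minima and maxima alternate along the path, so the difference of their numbers is
  decided by the kinds of its two end vertices, that is, by the first and the last step.\<close>

lemma card_extrema_diff:
  assumes "2 \<le> M" "x ` {1..<M} \<subseteq> {1, -1 :: int}"
  shows "2 * (int (card (maxima M x)) - int (card (minima M x))) = x (M - 1) - x 1"
proof -
  \<comment> \<open>Padding with 0 makes \<open>y (i - 1) - y i\<close> equal to 2 at an interior
    maximum, -2 at an interior minimum, and half of that at an end vertex. The two correction terms
    below supply the other half, and the rest telescopes to 0.\<close>
  define y where "y i = (if i = 0 then 0 else if i < M then x i else 0)" for i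
  have "int (card (maxima M x)) - int (card (minima M x)) =
      (\<Sum>i\<in>{1..M}. of_bool (i \<in> maxima M x) - of_bool (i \<in> minima M x))"
  proof -
    have sub: "maxima M x \<subseteq> {1..M}" "minima M x \<subseteq> {1..M}" by (auto simp: minima_def maxima_def)
    show ?thesis unfolding sum_subtractf sum_of_bool_set[OF sub(1)] sum_of_bool_set[OF sub(2)] ..
  qed
  also have "2 * \<dots> = (\<Sum>i\<in>{1..M}. y (i - 1) - y i + (if i = 1 then - x 1 else 0) + (if i = M then x (M - 1) else 0))"
    unfolding sum_distrib_left
  proof (rule sum.cong[OF refl])
    fix i assume i: "i \<in> {1..M}"
    then have "i \<noteq> M \<Longrightarrow> i \<in> {1..<M}" "i \<noteq> 1 \<Longrightarrow> i - 1 \<in> {1..<M}" by auto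
    then have "i \<noteq> M \<Longrightarrow> x i = 1 \<or> x i = -1" "i \<noteq> 1 \<Longrightarrow> x (i - 1) = 1 \<or> x (i - 1) = -1"
      using sign_cases[OF assms(2)] by blast+
    moreover have "1 < i \<longleftrightarrow> i \<noteq> 1" "i < M \<longleftrightarrow> i \<noteq> M" "M \<noteq> 1"
      "y i = (if i = M then 0 else x i)" "y (i - 1) = (if i = 1 then 0 else x (i - 1))"
      using i assms(1) by (auto simp: y_def)
    ultimately show "2 * (of_bool (i \<in> maxima M x) - of_bool (i \<in> minima M x)) =
        y (i - 1) - y i + (if i = 1 then - x 1 else 0) + (if i = M then x (M - 1) else 0)"
      using i unfolding minima_def maxima_def mem_Collect_eq
      by (cases "i = 1"; cases "i = M") auto
  qed
  also have "\<dots> = (\<Sum>i\<in>{1..M}. y (i - 1) - y i) - x 1 + x (M - 1)"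
    using assms(1) by (simp add: sum.distrib)
  also have "(\<Sum>i\<in>{1..M}. y (i - 1) - y i) = y 0 - y M"
    by (induction M) (simp_all add: y_def)
  also have "\<dots> = 0" by (simp add: y_def)
  finally show ?thesis by simp
qed

text \<open>All four counts are positive, so the sum of products is at least the number of turns of
  either walk plus 2; hence each walk turns at most twice. The numbers of minima and maxima are (1,
  1) without a turn, (2, 1) or (1, 2) with one turn after an initial rise or fall, and (2, 2) with
  two turns. This leaves a small table of products.\<close>

lemma unbent_count_eq_4_iff:
  assumes "2 \<le> m" "2 \<le> n"
    and "x ` {1..<m} \<subseteq> {1, -1 :: int}"
    and "y ` {1..<n} \<subseteq> {1, -1 :: int}"
  shows "card (minima m x) * card (minima n y) + card (maxima m x) * card (maxima n y) = 4 \<longleftrightarrow>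
    card (turns m x) = 0 \<and> card (turns n y) = 2 \<or> card (turns m x) = 2 \<and> card (turns n y) = 0 \<or>
    card (turns m x) = 1 \<and> card (turns n y) = 1 \<and> x 1 \<noteq> y 1" (is "?L = 4 \<longleftrightarrow> ?R")
proof -
  define t u where "t = card (turns m x)" and "u = card (turns n y)"
  define a a' where "a = card (minima m x)" and "a' = card (maxima m x)"
  define c c' where "c = card (minima n y)" and "c' = card (maxima n y)"
  have S: "a + a' = t + 2" "c + c' = u + 2"
    using card_extrema_sum[OF assms(1,3)] card_extrema_sum[OF assms(2,4)]
    by (simp_all add: t_def u_def a_def a'_def c_def c'_def)
  have x1: "x 1 = 1 \<or> x 1 = -1" and y1: "y 1 = 1 \<or> y 1 = -1"
    using sign_cases[OF assms(3), of 1] sign_cases[OF assms(4), of 1] assms(1,2) by auto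
  have xm: "x (m - 1) = x 1 * (-1) ^ t" and yn: "y (n - 1) = y 1 * (-1) ^ u"
    using sign_from_turns[OF assms(3), of "m - 1"] sign_from_turns[OF assms(4), of "n - 1"] assms(1,2)
    by (simp_all add: t_def u_def)
  have D: "2 * (int a' - int a) = x 1 * (-1) ^ t - x 1" "2 * (int c' - int c) = y 1 * (-1) ^ u - y 1"
    using card_extrema_diff[OF assms(1,3)] card_extrema_diff[OF assms(2,4)]
    unfolding xm yn by (simp_all add: a_def a'_def c_def c'_def)
  have pow: "(-1 :: int) ^ t = 1 \<or> (-1 :: int) ^ t = -1" "(-1 :: int) ^ u = 1 \<or> (-1 :: int) ^ u = -1"
    by (simp_all add: minus_one_power_iff)
  have pos: "1 \<le> a" "1 \<le> a'" "1 \<le> c" "1 \<le> c'"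
    using S D pow x1 y1 by auto
  have "a + a' \<le> a * c + a' * c'" "c + c' \<le> a * c + a' * c'"
    using pos by (auto intro!: add_mono)
  then have small: "t \<le> 2 \<and> u \<le> 2" if "a * c + a' * c' = 4" using that S by linarith
  show ?thesis
  proof (cases "t \<le> 2 \<and> u \<le> 2")
    case True
    have "t = 0 \<and> a = 1 \<and> a' = 1 \<or> t = 1 \<and> z = 1 \<and> a = 2 \<and> a' = 1 \<or>
       t = 1 \<and> z = -1 \<and> a = 1 \<and> a' = 2 \<or> t = 2 \<and> a = 2 \<and> a' = 2"
      if h: "t \<le> 2" "a + a' = t + 2" "2 * (int a' - int a) = z * (-1) ^ t - z" "z = 1 \<or> z = -1"
      for t a a' :: nat and z :: int
    proof -
      consider "t = 0" | "t = 1" | "t = 2" using h(1) by linarith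
      then show ?thesis using h(2-4) by cases auto
    qed
    from this[OF _ S(1) D(1) x1] this[OF _ S(2) D(2) y1] True have
      "t = 0 \<and> a = 1 \<and> a' = 1 \<or> t = 1 \<and> x 1 = 1 \<and> a = 2 \<and> a' = 1 \<or>
       t = 1 \<and> x 1 = -1 \<and> a = 1 \<and> a' = 2 \<or> t = 2 \<and> a = 2 \<and> a' = 2"
      "u = 0 \<and> c = 1 \<and> c' = 1 \<or> u = 1 \<and> y 1 = 1 \<and> c = 2 \<and> c' = 1 \<or>
       u = 1 \<and> y 1 = -1 \<and> c = 1 \<and> c' = 2 \<or> u = 2 \<and> c = 2 \<and> c' = 2"
      by simp_all
    then have "a * c + a' * c' = 4 \<longleftrightarrow> t = 0 \<and> u = 2 \<or> t = 2 \<and> u = 0 \<or> t = 1 \<and> u = 1 \<and> x 1 \<noteq> y 1"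
      by (elim disjE conjE) simp_all
    then show ?thesis by (simp add: t_def u_def a_def a'_def c_def c'_def)
  next
    case False
    then show ?thesis using small by (auto simp: t_def u_def a_def a'_def c_def c'_def)
  qed
qed

text \<open>The initial sign and the set of turns determine a sequence, through the parity of the
  number of turns passed, and every subset of the M - 2 interior vertices occurs as the set of
  turns.\<close>

lemma card_sign_sequences_turns:
  assumes "2 \<le> M" "s \<in> {1, -1}"
  shows "card {x \<in> sign_sequences M. x 1 = s \<and> card (turns M x) = t} = (M - 2) choose t"
proof -
  define f where "f T = (\<lambda>i\<in>{1..<M}. s * (-1) ^ card (T \<inter> {..i}))" for T :: "nat set"
  have step: "T \<inter> {..i} = (if i \<in> T then insert i (T \<inter> {..i - 1}) else T \<inter> {..i - 1})"
    if "1 \<le> i" for T and i :: nat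
  proof -
    have "{..i} = insert i {..i - 1}" using that by auto
    then show ?thesis by auto
  qed
  have f_seq: "f T \<in> sign_sequences M" for T
    using assms(2) by (auto simp: f_def sign_sequences_def minus_one_power_iff split: if_splits)
  have turns_f: "turns M (f T) = T" if "T \<subseteq> {2..<M}" for T
  proof -
    have "f T (i - 1) \<noteq> f T i \<longleftrightarrow> i \<in> T" if "i \<in> {2..<M}" for i
    proof -
      have "i \<notin> T \<inter> {..i - 1}" using that by auto
      then have "(-1 :: int) ^ card (T \<inter> {..i}) = (if i \<in> T then -1 else 1) * (-1) ^ card (T \<inter> {..i - 1})"
        using that by (subst step) auto
      then show ?thesis using that assms(2) by (auto simp: f_def)
    qed
    then show ?thesis using that unfolding turns_def by blast
  qed
  have f1: "f T 1 = s" if "T \<subseteq> {2..<M}" for T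
  proof -
    have "T \<inter> {..Suc 0} = {}" using that by force
    then show ?thesis using assms by (simp add: f_def)
  qed
  have "bij_betw (turns M) {x \<in> sign_sequences M. x 1 = s \<and> card (turns M x) = t} {T. T \<subseteq> {2..<M} \<and> card T = t}"
  proof (rule bij_betw_byWitness[where f' = f])
    show "\<forall>x\<in>{x \<in> sign_sequences M. x 1 = s \<and> card (turns M x) = t}. f (turns M x) = x"
    proof safe
      fix x assume x: "x \<in> sign_sequences M" "s = x 1"
      show "f (turns M x) = x"
      proof
        fix i
        show "f (turns M x) i = x i"
        proof (cases "i \<in> {1..<M}")
          case True
          have "turns M x \<inter> {..i} = turns (Suc i) x" using True by (auto simp: turns_def)
          then show ?thesis
            using sign_from_turns[OF sign_sequences_image[OF x(1)], of i] True x(2) by (auto simp: f_def)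
        next
          case False
          then have "x i = undefined" using x(1) PiE_arb unfolding sign_sequences_def by metis
          then show ?thesis using False by (auto simp: f_def)
        qed
      qed
    qed
    show "\<forall>T\<in>{T. T \<subseteq> {2..<M} \<and> card T = t}. turns M (f T) = T"
      using turns_f by blast
    show "turns M ` {x \<in> sign_sequences M. x 1 = s \<and> card (turns M x) = t} \<subseteq> {T. T \<subseteq> {2..<M} \<and> card T = t}"
      by (auto simp: turns_def)
    show "f ` {T. T \<subseteq> {2..<M} \<and> card T = t} \<subseteq> {x \<in> sign_sequences M. x 1 = s \<and> card (turns M x) = t}"
    proof safe
      fix T :: "nat set" assume T: "T \<subseteq> {2..<M}"
      show "f T \<in> sign_sequences M" "f T 1 = s" "card (turns M (f T)) = card T"
        by (fact f_seq, fact f1[OF T], simp only: turns_f[OF T])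
    qed
  qed
  then have "card {x \<in> sign_sequences M. x 1 = s \<and> card (turns M x) = t} = card {T. T \<subseteq> {2..<M} \<and> card T = t}"
    by (rule bij_betw_same_card)
  then show ?thesis by (simp add: n_subsets)
qed

section \<open>Fields with a single saddle\<close>

text \<open>The step data of a field with bottom row x, left column y and a single saddle at (p, q).\<close>

definition bent_b :: "(nat \<Rightarrow> int) \<Rightarrow> nat \<Rightarrow> nat \<Rightarrow> nat \<Rightarrow> nat \<Rightarrow> int" where
  "bent_b x p q i j = (if i = p \<and> q < j then - x i else x i)"

definition bent_l :: "(nat \<Rightarrow> int) \<Rightarrow> nat \<Rightarrow> nat \<Rightarrow> nat \<Rightarrow> nat \<Rightarrow> int" where
  "bent_l y p q i j = (if j = q \<and> p < i then - y j else y j)"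

lemma extrema_cong:
  assumes "\<And>i j. i \<in> {1..<m} \<Longrightarrow> j \<in> {1..n} \<Longrightarrow> b i j = b' i j"
    and "\<And>i j. i \<in> {1..m} \<Longrightarrow> j \<in> {1..<n} \<Longrightarrow> l i j = l' i j"
  shows "extrema m n b l = extrema m n b' l'"
proof -
  have "(i \<in> minima m (\<lambda>i. b i j) \<longleftrightarrow> i \<in> minima m (\<lambda>i. b' i j)) \<and>
        (i \<in> maxima m (\<lambda>i. b i j) \<longleftrightarrow> i \<in> maxima m (\<lambda>i. b' i j))" if "j \<in> {1..n}" for i j
    using assms(1)[OF _ that, of i] assms(1)[OF _ that, of "i - 1"] by (force simp: minima_def maxima_def)
  moreover have "(j \<in> minima n (l i) \<longleftrightarrow> j \<in> minima n (l' i)) \<and>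
        (j \<in> maxima n (l i) \<longleftrightarrow> j \<in> maxima n (l' i))" if "i \<in> {1..m}" for i j
    using assms(2)[OF that, of j] assms(2)[OF that, of "j - 1"] by (force simp: minima_def maxima_def)
  moreover have "i \<in> {1..m}" if "i \<in> minima m f \<or> i \<in> maxima m f" for i m f
    using that by (auto simp: minima_def maxima_def)
  ultimately show ?thesis unfolding extrema_def by blast
qed

lemma card_extrema_unbent:
  assumes "2 \<le> m"
  shows "card (extrema m n (\<lambda>i j. x i) (\<lambda>i j. y j)) =
    card (minima m x) * card (minima n y) + card (maxima m x) * card (maxima n y)"
proof -
  have "extrema m n (\<lambda>i j. x i) (\<lambda>i j. y j) = minima m x \<times> minima n y \<union> maxima m x \<times> maxima n y"
    by (auto simp: extrema_def)
  moreover have "(minima m x \<times> minima n y) \<inter> (maxima m x \<times> maxima n y) = {}"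
    using minima_maxima_disjoint[OF assms, of x] by auto
  ultimately show ?thesis by (simp add: card_Un_disjoint card_cartesian_product)
qed

section \<open>Extrema of a walk on either side of a distinguished step\<close>

lemma minima_uminus: "minima M (\<lambda>i. - x i) = maxima M x"
  and maxima_uminus: "maxima M (\<lambda>i. - x i) = minima M x"
  by (auto simp: minima_def maxima_def minus_equation_iff[of _ 1])

lemma extrema_uminus: "extrema m n (\<lambda>i j. - b i j) (\<lambda>i j. - l i j) = extrema m n b l"
  by (auto simp: extrema_def minima_uminus maxima_uminus)

text \<open>In a field with its saddle at \<open>(p, q)\<close>, the rows above the saddle follow
  \<open>flip_step p x\<close> and the columns to the right of it follow
  \<open>flip_step q y\<close>.\<close>

definition flip_step :: "nat \<Rightarrow> (nat \<Rightarrow> int) \<Rightarrow> nat \<Rightarrow> int" where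
  "flip_step p x = x(p := - x p)"

lemma flip_step_image: "x ` A \<subseteq> {1, -1} \<Longrightarrow> flip_step p x ` A \<subseteq> {1, -1}"
  by (auto simp: flip_step_def)

text \<open>The first upward step from \<open>a\<close> on starts at a minimum, since it is preceded
  by a downward step or by nothing at all.\<close>

lemma exists_minimum:
  assumes "x ` {1..<M} \<subseteq> {1, -1}" "1 \<le> a" "a \<le> c" "c < M" "x c = 1" "a = 1 \<or> x (a - 1) = -1"
  shows "\<exists>i\<in>{a..c}. i \<in> minima M x"
proof -
  define i where "i = (LEAST i. a \<le> i \<and> x i = 1)"
  have i: "a \<le> i" "x i = 1" "i \<le> c"
    using LeastI[of "\<lambda>i. a \<le> i \<and> x i = 1" c] Least_le[of "\<lambda>i. a \<le> i \<and> x i = 1" c] assms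
    by (auto simp: i_def)
  have "x (i - 1) = -1" if "1 < i"
  proof (cases "i = a")
    case True
    then show ?thesis using assms that by auto
  next
    case False
    then have "\<not> (a \<le> i - 1 \<and> x (i - 1) = 1)"
      using not_less_Least[of "i - 1" "\<lambda>i. a \<le> i \<and> x i = 1"] that unfolding i_def[symmetric] by auto
    moreover have "a \<le> i - 1" "i - 1 \<in> {1..<M}" using False i assms that by auto
    ultimately show ?thesis using sign_cases[OF assms(1), of "i - 1"] by auto
  qed
  then show ?thesis using i assms by (intro bexI[of _ i]) (auto simp: minima_def)
qed

lemma exists_maximum:
  assumes "x ` {1..<M} \<subseteq> {1, -1}" "1 \<le> a" "a \<le> c" "c < M" "x c = -1" "a = 1 \<or> x (a - 1) = 1"
  shows "\<exists>i\<in>{a..c}. i \<in> maxima M x"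
proof -
  have "(\<lambda>i. - x i) ` {1..<M} \<subseteq> {1, -1}" using assms(1) by fastforce
  from exists_minimum[OF this assms(2-4)] show ?thesis
    using assms(5,6) by (simp add: minima_uminus)
qed

lemma card_ge_2: "finite A \<Longrightarrow> i \<in> A \<Longrightarrow> j \<in> A \<Longrightarrow> i \<noteq> j \<Longrightarrow> 2 \<le> card A"
  using card_mono[of A "{i, j}"] by auto

text \<open>A walk that leaves \<open>p\<close> upwards must begin to rise at some vertex up to
  \<open>p\<close>; with step \<open>p\<close> reversed it must begin to fall at such a vertex.
  These vertices supply the guaranteed extrema of the quadrants.\<close>

lemma low_part_pos:
  assumes "x ` {1..<M} \<subseteq> {1, -1}" "p \<in> {1..<M}" "x p = 1"
  shows "1 \<le> card (minima M x \<inter> {..p})" "1 \<le> card (maxima M (flip_step p x) \<inter> {..p})"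
proof -
  have "minima M x \<inter> {..p} \<noteq> {}"
    using exists_minimum[OF assms(1), of 1 p] assms(2,3) by auto
  then show "1 \<le> card (minima M x \<inter> {..p})" by (simp add: Suc_le_eq card_gt_0_iff)
  have "maxima M (flip_step p x) \<inter> {..p} \<noteq> {}"
    using exists_maximum[OF flip_step_image[OF assms(1)], of 1 p p] assms(2,3) by (auto simp: flip_step_def)
  then show "1 \<le> card (maxima M (flip_step p x) \<inter> {..p})" by (simp add: Suc_le_eq card_gt_0_iff)
qed

text \<open>A turn before \<open>p\<close> creates a second extremum in this part. A turn from up to
  down gives two minima of \<open>x\<close>, one on either side of the falling step; a turn from
  down to up gives two maxima of the flipped walk. Each of the two counts excludes one kind of
  turn.\<close>

lemma low_part_const:
  assumes "x ` {1..<M} \<subseteq> {1, -1}" "p \<in> {1..<M}" "x p = 1"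
    and "card (minima M x \<inter> {..p}) = 1" "card (maxima M (flip_step p x) \<inter> {..p}) = 1"
  shows "\<forall>i\<in>{1..<p}. x i = x 1"
proof (rule ccontr)
  assume "\<not> ?thesis"
  then have "\<exists>i. i \<in> {1..<p} \<and> x i \<noteq> x 1" by auto
  then obtain k where k: "k \<in> {1..<p}" "x k \<noteq> x 1" "\<And>i. i < k \<Longrightarrow> \<not> (i \<in> {1..<p} \<and> x i \<noteq> x 1)"
    using exists_least_iff[of "\<lambda>i. i \<in> {1..<p} \<and> x i \<noteq> x 1"] by blast
  define i where "i = k - 1"
  have "k \<noteq> 1" using k by auto
  then have i: "1 \<le> i" "i + 1 < p" "k = i + 1" using k(1) by (auto simp: i_def)
  then have "x i = x 1" using k(3)[of i] by auto
  then have ne: "x i \<noteq> x (i + 1)" using k(2) i(3) by metis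
  have sgn: "x i = 1 \<or> x i = -1" "x (i + 1) = 1 \<or> x (i + 1) = -1"
    using sign_cases[OF assms(1), of i] sign_cases[OF assms(1), of "i + 1"] i assms(2) by auto
  show False
  proof (cases "x i = 1")
    case True
    then have "x (i + 1) = -1" using ne sgn by auto
    then obtain u v where "u \<in> {1..i}" "u \<in> minima M x" "v \<in> {i + 2..p}" "v \<in> minima M x"
      using exists_minimum[OF assms(1), of 1 i] exists_minimum[OF assms(1), of "i + 2" p] True i assms(2,3) by auto
    then have "2 \<le> card (minima M x \<inter> {..p})" using i by (intro card_ge_2[of _ u v]) auto
    then show False using assms(4) by simp
  next
    case False
    then have "x i = -1" "x (i + 1) = 1" using ne sgn by auto
    then have "flip_step p x i = -1" "flip_step p x (i + 1) = 1" "flip_step p x p = -1"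
      using i assms(3) by (auto simp: flip_step_def)
    then obtain u v where "u \<in> {1..i}" "u \<in> maxima M (flip_step p x)" "v \<in> {i + 2..p}" "v \<in> maxima M (flip_step p x)"
      using exists_maximum[OF flip_step_image[OF assms(1)], of 1 i p]
        exists_maximum[OF flip_step_image[OF assms(1)], of "i + 2" p p] i assms(2) by auto
    then have "2 \<le> card (maxima M (flip_step p x) \<inter> {..p})" using i by (intro card_ge_2[of _ u v]) auto
    then show False using assms(5) by simp
  qed
qed

lemma low_part_of_const:
  assumes "x ` {1..<M} \<subseteq> {1, -1}" "p \<in> {1..<M}" "x p = 1" "\<forall>i\<in>{1..<p}. x i = x 1"
  shows "card (minima M x \<inter> {..p}) = 1" "card (maxima M (flip_step p x) \<inter> {..p}) = 1"
    and "card (maxima M x \<inter> {..p}) = 0 \<longleftrightarrow> p = 1 \<or> x 1 = 1"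
    and "card (minima M (flip_step p x) \<inter> {..p}) = 0 \<longleftrightarrow> p = 1 \<or> x 1 = -1"
proof -
  have mx: "minima M z \<inter> {..p} = {i \<in> {1..p}. (i \<noteq> 1 \<longrightarrow> z (i - 1) = -1) \<and> z i = 1}"
    "maxima M z \<inter> {..p} = {i \<in> {1..p}. (i \<noteq> 1 \<longrightarrow> z (i - 1) = 1) \<and> z i = -1}" for z
    using assms(2) by (auto simp: minima_def maxima_def)
  define c where "c = x 1"
  have c: "c = 1 \<or> c = -1" using sign_cases[OF assms(1), of 1] assms(2) by (auto simp: c_def)
  have x: "x i = (if i = p then 1 else c)" "flip_step p x i = (if i = p then -1 else c)" if "i \<in> {1..p}" for i
  proof -
    have "i \<noteq> p \<Longrightarrow> i \<in> {1..<p}" using that by auto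
    then have "i \<noteq> p \<Longrightarrow> x i = c" using assms(4) unfolding c_def by blast
    then show "x i = (if i = p then 1 else c)" "flip_step p x i = (if i = p then -1 else c)"
      using assms(3) by (auto simp: flip_step_def)
  qed
  have x': "x (i - 1) = c" "flip_step p x (i - 1) = c" if "i \<in> {1..p}" "i \<noteq> 1" for i
  proof -
    have "i - 1 \<in> {1..p}" "i - 1 \<noteq> p" using that by auto
    then show "x (i - 1) = c" "flip_step p x (i - 1) = c" using x[of "i - 1"] by simp_all
  qed
  have p: "1 \<in> {1..p}" "p \<in> {1..p}" using assms(2) by auto
  have A: "minima M x \<inter> {..p} = {i \<in> {1..p}. (i \<noteq> 1 \<longrightarrow> c = -1) \<and> (i \<noteq> p \<longrightarrow> c = 1)}"
    unfolding mx by (intro Collect_cong conj_cong refl) (simp_all add: x x' del: One_nat_def)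
  have B: "maxima M (flip_step p x) \<inter> {..p} = {i \<in> {1..p}. (i \<noteq> 1 \<longrightarrow> c = 1) \<and> (i \<noteq> p \<longrightarrow> c = -1)}"
    unfolding mx by (intro Collect_cong conj_cong refl) (simp_all add: x x' del: One_nat_def)
  have C: "maxima M x \<inter> {..p} = {i \<in> {1..p}. (i \<noteq> 1 \<longrightarrow> c = 1) \<and> i \<noteq> p \<and> c = -1}"
    unfolding mx by (intro Collect_cong conj_cong refl) (simp_all add: x x' del: One_nat_def)
  have D: "minima M (flip_step p x) \<inter> {..p} = {i \<in> {1..p}. (i \<noteq> 1 \<longrightarrow> c = -1) \<and> i \<noteq> p \<and> c = 1}"
    unfolding mx by (intro Collect_cong conj_cong refl) (simp_all add: x x' del: One_nat_def)
  have "minima M x \<inter> {..p} = (if c = 1 then {1} else {p})"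
    "maxima M (flip_step p x) \<inter> {..p} = (if c = -1 then {1} else {p})"
    "maxima M x \<inter> {..p} = (if p = 1 \<or> c = 1 then {} else {1})"
    "minima M (flip_step p x) \<inter> {..p} = (if p = 1 \<or> c = -1 then {} else {1})"
    unfolding A B C D using c p by (elim disjE; force)+
  then show "card (minima M x \<inter> {..p}) = 1" "card (maxima M (flip_step p x) \<inter> {..p}) = 1"
    and "card (maxima M x \<inter> {..p}) = 0 \<longleftrightarrow> p = 1 \<or> x 1 = 1"
    and "card (minima M (flip_step p x) \<inter> {..p}) = 0 \<longleftrightarrow> p = 1 \<or> x 1 = -1"
    unfolding c_def[symmetric] by simp_all
qed

text \<open>Reversal sends vertex i to M + 1 - i and step i to M - i. The sign of a step is kept
  although its direction is reversed, so minima and maxima are exchanged; in return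
  \<open>x p = 1\<close> remains positive, and the facts about the lower part can be applied to the
  reversed walk as they are.\<close>

lemma card_high_part:
  assumes "p \<in> {1..<M}"
  shows "card (maxima M x \<inter> {p<..}) = card (minima M (\<lambda>i. x (M - i)) \<inter> {..M - p})"
    and "card (minima M x \<inter> {p<..}) = card (maxima M (\<lambda>i. x (M - i)) \<inter> {..M - p})"
proof -
  have mem: "M + 1 - i \<in> minima M (\<lambda>i. x (M - i)) \<longleftrightarrow> i \<in> maxima M x"
    "M + 1 - i \<in> maxima M (\<lambda>i. x (M - i)) \<longleftrightarrow> i \<in> minima M x" if "i \<in> {1..M}" for i
  proof -
    have eq: "M - (M + 1 - i) = i - 1" "M - (M + 1 - i - 1) = i"
      "1 < M + 1 - i \<longleftrightarrow> i < M" "M + 1 - i < M \<longleftrightarrow> 1 < i" "M + 1 - i \<in> {1..M}"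
      using that by auto
    show "M + 1 - i \<in> minima M (\<lambda>i. x (M - i)) \<longleftrightarrow> i \<in> maxima M x"
      "M + 1 - i \<in> maxima M (\<lambda>i. x (M - i)) \<longleftrightarrow> i \<in> minima M x"
      unfolding minima_def maxima_def mem_Collect_eq eq using eq(5) that by blast+
  qed
  have bij: "card (A \<inter> {p<..}) = card (B \<inter> {..M - p})"
    if sub: "A \<subseteq> {1..M}" "B \<subseteq> {1..M}" and h: "\<And>i. i \<in> {1..M} \<Longrightarrow> M + 1 - i \<in> B \<longleftrightarrow> i \<in> A" for A B
  proof (rule bij_betw_same_card[of "\<lambda>i. M + 1 - i"], rule bij_betw_byWitness[where f' = "\<lambda>i. M + 1 - i"])
    have inv: "M + 1 - (M + 1 - i) = i" if "i \<in> {1..M}" for i using that by auto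
    show "\<forall>i\<in>A \<inter> {p<..}. M + 1 - (M + 1 - i) = i" "\<forall>i\<in>B \<inter> {..M - p}. M + 1 - (M + 1 - i) = i"
      using sub inv by blast+
    show "(\<lambda>i. M + 1 - i) ` (A \<inter> {p<..}) \<subseteq> B \<inter> {..M - p}"
    proof
      fix k assume "k \<in> (\<lambda>i. M + 1 - i) ` (A \<inter> {p<..})"
      then obtain i where i: "i \<in> A" "p < i" "k = M + 1 - i" by auto
      then have "i \<in> {1..M}" using sub by auto
      then show "k \<in> B \<inter> {..M - p}" using h[of i] i by auto
    qed
    show "(\<lambda>i. M + 1 - i) ` (B \<inter> {..M - p}) \<subseteq> A \<inter> {p<..}"
    proof
      fix k assume "k \<in> (\<lambda>i. M + 1 - i) ` (B \<inter> {..M - p})"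
      then obtain i where i: "i \<in> B" "i \<le> M - p" "k = M + 1 - i" by auto
      then have "i \<in> {1..M}" using sub by auto
      then have "k \<in> {1..M}" "M + 1 - k = i" "p < k" using i assms by auto
      then show "k \<in> A \<inter> {p<..}" using h[of k] i by auto
    qed
  qed
  have sub: "minima M z \<subseteq> {1..M}" "maxima M z \<subseteq> {1..M}" for z
    by (auto simp: minima_def maxima_def)
  show "card (maxima M x \<inter> {p<..}) = card (minima M (\<lambda>i. x (M - i)) \<inter> {..M - p})"
    "card (minima M x \<inter> {p<..}) = card (maxima M (\<lambda>i. x (M - i)) \<inter> {..M - p})"
    by (rule bij[OF sub(2) sub(1) mem(1)] bij[OF sub(1) sub(2) mem(2)]; assumption)+
qed

definition one_bend :: "nat \<Rightarrow> nat \<Rightarrow> (nat \<Rightarrow> int) \<Rightarrow> bool" where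
  "one_bend M p x \<longleftrightarrow> (\<forall>i\<in>{1..<p}. x i = x 1) \<and> (\<forall>i\<in>{p<..<M}. x i = x (M - 1))"

lemma high_part:
  assumes "x ` {1..<M} \<subseteq> {1, -1}" "p \<in> {1..<M}" "x p = 1"
  shows "1 \<le> card (maxima M x \<inter> {p<..})" "1 \<le> card (minima M (flip_step p x) \<inter> {p<..})"
    and "card (maxima M x \<inter> {p<..}) = 1 \<Longrightarrow> card (minima M (flip_step p x) \<inter> {p<..}) = 1 \<Longrightarrow>
      \<forall>i\<in>{p<..<M}. x i = x (M - 1)"
    and "\<forall>i\<in>{p<..<M}. x i = x (M - 1) \<Longrightarrow> card (maxima M x \<inter> {p<..}) = 1"
    and "\<forall>i\<in>{p<..<M}. x i = x (M - 1) \<Longrightarrow> card (minima M (flip_step p x) \<inter> {p<..}) = 1"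
    and "\<forall>i\<in>{p<..<M}. x i = x (M - 1) \<Longrightarrow>
      card (minima M x \<inter> {p<..}) = 0 \<longleftrightarrow> p = M - 1 \<or> x (M - 1) = 1"
    and "\<forall>i\<in>{p<..<M}. x i = x (M - 1) \<Longrightarrow>
      card (maxima M (flip_step p x) \<inter> {p<..}) = 0 \<longleftrightarrow> p = M - 1 \<or> x (M - 1) = -1"
proof -
  define y where "y = (\<lambda>i. x (M - i))"
  have "M - i \<in> {1..<M}" if "i \<in> {1..<M}" for i using that by auto
  then have y: "y ` {1..<M} \<subseteq> {1, -1}" using assms(1) unfolding y_def by blast
  have p: "M - p \<in> {1..<M}" "y (M - p) = 1" using assms(2,3) by (auto simp: y_def)
  have fl: "minima M (\<lambda>i. flip_step p x (M - i)) = minima M (flip_step (M - p) y)"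
    "maxima M (\<lambda>i. flip_step p x (M - i)) = maxima M (flip_step (M - p) y)"
  proof -
    have cong: "minima M z = minima M w" "maxima M z = maxima M w" if "\<And>i. i \<le> M \<Longrightarrow> z i = w i" for z w
      by (auto simp: minima_def maxima_def that)
    have eq: "flip_step p x (M - i) = flip_step (M - p) y i" if "i \<le> M" for i
      using assms(2) that by (auto simp: flip_step_def y_def)
    show "minima M (\<lambda>i. flip_step p x (M - i)) = minima M (flip_step (M - p) y)"
      by (rule cong(1)[OF eq])
    show "maxima M (\<lambda>i. flip_step p x (M - i)) = maxima M (flip_step (M - p) y)"
      by (rule cong(2)[OF eq])
  qed
  have const: "(\<forall>i\<in>{1..<M - p}. y i = y 1) \<longleftrightarrow> (\<forall>i\<in>{p<..<M}. x i = x (M - 1))"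
  proof safe
    fix i assume h: "\<forall>i\<in>{1..<M - p}. y i = y 1" and i: "i \<in> {p<..<M}"
    then have "M - i \<in> {1..<M - p}" "M - (M - i) = i" by auto
    then show "x i = x (M - 1)" using h unfolding y_def by metis
  next
    fix i assume h: "\<forall>i\<in>{p<..<M}. x i = x (M - 1)" and i: "i \<in> {1..<M - p}"
    then have "M - i \<in> {p<..<M}" by auto
    then show "y i = y 1" using h unfolding y_def by blast
  qed
  have y1: "y 1 = x (M - 1)" by (simp add: y_def)
  have p1: "M - p = 1 \<longleftrightarrow> p = M - 1" using assms(2) by auto
  note c = card_high_part[OF assms(2), of x, folded y_def]
    card_high_part[OF assms(2), of "flip_step p x", unfolded fl]
  note low = low_part_pos[OF y p] low_part_const[OF y p, unfolded const]
    low_part_of_const[OF y p, unfolded const, unfolded y1 p1]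
  show "1 \<le> card (maxima M x \<inter> {p<..})" "1 \<le> card (minima M (flip_step p x) \<inter> {p<..})"
    "card (maxima M x \<inter> {p<..}) = 1 \<Longrightarrow> card (minima M (flip_step p x) \<inter> {p<..}) = 1 \<Longrightarrow>
      \<forall>i\<in>{p<..<M}. x i = x (M - 1)"
    "\<forall>i\<in>{p<..<M}. x i = x (M - 1) \<Longrightarrow> card (maxima M x \<inter> {p<..}) = 1"
    "\<forall>i\<in>{p<..<M}. x i = x (M - 1) \<Longrightarrow> card (minima M (flip_step p x) \<inter> {p<..}) = 1"
    "\<forall>i\<in>{p<..<M}. x i = x (M - 1) \<Longrightarrow>
      card (minima M x \<inter> {p<..}) = 0 \<longleftrightarrow> p = M - 1 \<or> x (M - 1) = 1"
    "\<forall>i\<in>{p<..<M}. x i = x (M - 1) \<Longrightarrow>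
      card (maxima M (flip_step p x) \<inter> {p<..}) = 0 \<longleftrightarrow> p = M - 1 \<or> x (M - 1) = -1"
    unfolding c by (rule low; assumption)+
qed

section \<open>The four quadrants around a single saddle\<close>

lemma extrema_bent:
  fixes x y :: "nat \<Rightarrow> int"
  assumes p: "p \<in> {1..<m}" and q: "q \<in> {1..<n}"
  defines "x' \<equiv> flip_step p x" and "y' \<equiv> flip_step q y"
  shows "extrema m n (bent_b x p q) (bent_l y p q) =
    ((minima m x \<inter> {..p}) \<times> (minima n y \<inter> {..q}) \<union> (maxima m x \<inter> {..p}) \<times> (maxima n y \<inter> {..q})) \<union>
    ((minima m x \<inter> {p<..}) \<times> (minima n y' \<inter> {..q}) \<union> (maxima m x \<inter> {p<..}) \<times> (maxima n y' \<inter> {..q})) \<union>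
    ((minima m x' \<inter> {..p}) \<times> (minima n y \<inter> {q<..}) \<union> (maxima m x' \<inter> {..p}) \<times> (maxima n y \<inter> {q<..})) \<union>
    ((minima m x' \<inter> {p<..}) \<times> (minima n y' \<inter> {q<..}) \<union> (maxima m x' \<inter> {p<..}) \<times> (maxima n y' \<inter> {q<..}))"
    (is "?E = ?Q")
proof -
  \<comment> \<open>A row depends on its position only through the side of the saddle on which it
    lies, and so does a column. Hence the extrema in each quadrant form products, each quadrant
    having its own pair of walks.\<close>
  have b: "(\<lambda>i. bent_b x p q i j) = (if j \<le> q then x else x')" for j
    by (auto simp: bent_b_def x'_def flip_step_def)
  have l: "bent_l y p q i = (if i \<le> p then y else y')" for i
    by (auto simp: bent_l_def y'_def flip_step_def)
  have "(i, j) \<in> ?E \<longleftrightarrow> (i, j) \<in> ?Q" for i j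
    unfolding extrema_def mem_Collect_eq case_prod_conv b l
    by (cases "i \<le> p"; cases "j \<le> q") auto
  then show ?thesis by (intro set_eqI) (metis surj_pair)
qed

lemma card_extrema_bent:
  fixes x y :: "nat \<Rightarrow> int"
  assumes p: "p \<in> {1..<m}" and q: "q \<in> {1..<n}"
  defines "x' \<equiv> flip_step p x" and "y' \<equiv> flip_step q y"
  shows "card (extrema m n (bent_b x p q) (bent_l y p q)) =
    card (minima m x \<inter> {..p}) * card (minima n y \<inter> {..q}) + card (maxima m x \<inter> {..p}) * card (maxima n y \<inter> {..q}) +
    (card (minima m x \<inter> {p<..}) * card (minima n y' \<inter> {..q}) + card (maxima m x \<inter> {p<..}) * card (maxima n y' \<inter> {..q})) +
    (card (minima m x' \<inter> {..p}) * card (minima n y \<inter> {q<..}) + card (maxima m x' \<inter> {..p}) * card (maxima n y \<inter> {q<..})) +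
    (card (minima m x' \<inter> {p<..}) * card (minima n y' \<inter> {q<..}) + card (maxima m x' \<inter> {p<..}) * card (maxima n y' \<inter> {q<..}))"
proof -
  have "2 \<le> m" using p by auto
  note dj = minima_maxima_disjoint[OF this]
  have pair: "card ((minima m z \<inter> A) \<times> (minima n w \<inter> B) \<union> (maxima m z \<inter> A) \<times> (maxima n w \<inter> B)) =
      card (minima m z \<inter> A) * card (minima n w \<inter> B) + card (maxima m z \<inter> A) * card (maxima n w \<inter> B)" for z w A B
    using dj[of z] by (subst card_Un_disjoint) (auto simp: card_cartesian_product)
  show ?thesis
    unfolding extrema_bent[OF p q] x'_def[symmetric] y'_def[symmetric]
    by (subst card_Un_disjoint, simp, simp, force)+ (simp only: pair)
qed

text \<open>The saddle divides the grid into four quadrants, each of which contains an extremum; the four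
  disjunctions say that no quadrant contains a second one.\<close>

definition bent_ok :: "nat \<Rightarrow> nat \<Rightarrow> nat \<Rightarrow> nat \<Rightarrow> (nat \<Rightarrow> int) \<Rightarrow> (nat \<Rightarrow> int) \<Rightarrow> bool" where
  "bent_ok m n p q x y \<longleftrightarrow> one_bend m p x \<and> one_bend n q y \<and>
     (p = 1 \<or> q = 1 \<or> x 1 = x p \<or> y 1 = x p) \<and>
     (p = m - 1 \<or> q = 1 \<or> x (m - 1) = x p \<or> y 1 = - x p) \<and>
     (p = 1 \<or> q = n - 1 \<or> x 1 = - x p \<or> y (n - 1) = x p) \<and>
     (p = m - 1 \<or> q = n - 1 \<or> x (m - 1) = - x p \<or> y (n - 1) = - x p)"

text \<open>Tailored to the quadrants: each contributes a guaranteed product of positive counts and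
  a remainder from the other kind of extremum. With sign 1 at the saddle, minima are guaranteed at
  the lower left and upper right and maxima in the other two quadrants, hence the positions of
  \<open>r1\<close> to \<open>r4\<close>.\<close>

lemma sum_of_four_products:
  fixes a b c d e f g h r1 r2 r3 r4 :: nat
  assumes "1 \<le> a" "1 \<le> b" "1 \<le> c" "1 \<le> d" "1 \<le> e" "1 \<le> f" "1 \<le> g" "1 \<le> h"
  shows "a * b + r1 + (r2 + c * d) + (r3 + e * f) + (g * h + r4) = 4 \<longleftrightarrow>
    a = 1 \<and> b = 1 \<and> c = 1 \<and> d = 1 \<and> e = 1 \<and> f = 1 \<and> g = 1 \<and> h = 1 \<and> r1 = 0 \<and> r2 = 0 \<and> r3 = 0 \<and> r4 = 0"
    (is "?L = 4 \<longleftrightarrow> ?R")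
proof
  assume L: "?L = 4"
  have "1 \<le> a * b" "1 \<le> c * d" "1 \<le> e * f" "1 \<le> g * h"
    using assms by (simp_all add: Suc_le_eq)
  then have "a * b = 1" "c * d = 1" "e * f = 1" "g * h = 1" "r1 = 0" "r2 = 0" "r3 = 0" "r4 = 0"
    using L by linarith+
  then show ?R by simp
qed simp

lemma card_extrema_bent_eq_4_pos:
  assumes x: "x ` {1..<m} \<subseteq> {1, -1}" and y: "y ` {1..<n} \<subseteq> {1, -1}"
    and p: "p \<in> {1..<m}" and q: "q \<in> {1..<n}" and xp: "x p = 1" and yq: "y q = 1"
  shows "card (extrema m n (bent_b x p q) (bent_l y p q)) = 4 \<longleftrightarrow> bent_ok m n p q x y"
proof -
  note lx = low_part_pos[OF x p xp] and ly = low_part_pos[OF y q yq]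
  note hx = high_part[OF x p xp] and hy = high_part[OF y q yq]
  note count = card_extrema_bent[OF p q, of x y]
    sum_of_four_products[OF lx(1) ly(1) hx(1) ly(2) lx(2) hy(1) hx(2) hy(2)]
  show ?thesis
  proof (cases "one_bend m p x \<and> one_bend n q y")
    case True
    then have cx: "\<forall>i\<in>{1..<p}. x i = x 1" "\<forall>i\<in>{p<..<m}. x i = x (m - 1)"
      and cy: "\<forall>i\<in>{1..<q}. y i = y 1" "\<forall>i\<in>{q<..<n}. y i = y (n - 1)"
      unfolding one_bend_def by blast+
    note vals = low_part_of_const[OF x p xp cx(1)] low_part_of_const[OF y q yq cy(1)]
      hx(4-7)[OF cx(2)] hy(4-7)[OF cy(2)]
    have "bent_ok m n p q x y \<longleftrightarrow>
       (p = 1 \<or> q = 1 \<or> x 1 = 1 \<or> y 1 = 1) \<and>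
       (p = m - 1 \<or> q = 1 \<or> x (m - 1) = 1 \<or> y 1 = - 1) \<and>
       (p = 1 \<or> q = n - 1 \<or> x 1 = - 1 \<or> y (n - 1) = 1) \<and>
       (p = m - 1 \<or> q = n - 1 \<or> x (m - 1) = - 1 \<or> y (n - 1) = - 1)"
      using True by (simp add: bent_ok_def xp)
    then show ?thesis
      unfolding count unfolding mult_eq_0_iff vals by blast
  next
    case False
    have "card (extrema m n (bent_b x p q) (bent_l y p q)) \<noteq> 4"
    proof
      assume "card (extrema m n (bent_b x p q) (bent_l y p q)) = 4"
      note * = this[unfolded count]
      have "one_bend m p x" "one_bend n q y"
        using low_part_const[OF x p xp] low_part_const[OF y q yq] hx(3) hy(3) *
        unfolding one_bend_def by blast+
      then show False using False by blast
    qed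
    then show ?thesis using False unfolding bent_ok_def by blast
  qed
qed

text \<open>Negating all steps turns the height upside down. This exchanges minima and maxima and
  preserves the conditions in \<open>bent_ok\<close>, so the sign at the saddle may be taken to be
  1.\<close>

lemma card_extrema_bent_eq_4:
  assumes x: "x ` {1..<m} \<subseteq> {1, -1}" and y: "y ` {1..<n} \<subseteq> {1, -1}"
    and p: "p \<in> {1..<m}" and q: "q \<in> {1..<n}" and xy: "x p = y q"
  shows "card (extrema m n (bent_b x p q) (bent_l y p q)) = 4 \<longleftrightarrow> bent_ok m n p q x y"
proof (cases "x p = 1")
  case True
  then show ?thesis using card_extrema_bent_eq_4_pos[OF x y p q] xy by simp
next
  case False
  then have xp: "x p = -1" using sign_cases[OF x p] by simp
  have x': "(\<lambda>i. - x i) ` {1..<m} \<subseteq> {1, -1}" and y': "(\<lambda>i. - y i) ` {1..<n} \<subseteq> {1, -1}"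
    using x y by fastforce+
  have "bent_b (\<lambda>i. - x i) p q = (\<lambda>i j. - bent_b x p q i j)" "bent_l (\<lambda>i. - y i) p q = (\<lambda>i j. - bent_l y p q i j)"
    by (auto simp: bent_b_def bent_l_def fun_eq_iff)
  moreover have "bent_ok m n p q (\<lambda>i. - x i) (\<lambda>i. - y i) \<longleftrightarrow> bent_ok m n p q x y"
  proof -
    have neg: "- a = b \<longleftrightarrow> a = - b" for a b :: int by auto
    show ?thesis unfolding bent_ok_def one_bend_def neg minus_minus ..
  qed
  ultimately show ?thesis
    using card_extrema_bent_eq_4_pos[OF x' y' p q] xp xy by (simp add: extrema_uminus)
qed

section \<open>Counting step data\<close>

definition unbent_pairs :: "nat \<Rightarrow> nat \<Rightarrow> ((nat \<Rightarrow> int) \<times> (nat \<Rightarrow> int)) set" where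
  "unbent_pairs m n = {(x, y) \<in> sign_sequences m \<times> sign_sequences n.
     card (extrema m n (\<lambda>i j. x i) (\<lambda>i j. y j)) = 4}"

text \<open>The equation \<open>x p = y q\<close> is the sign pattern of a saddle: the two steps
  that leave its lower left corner agree.\<close>

definition bent_pairs :: "nat \<Rightarrow> nat \<Rightarrow> nat \<Rightarrow> nat \<Rightarrow> ((nat \<Rightarrow> int) \<times> (nat \<Rightarrow> int)) set" where
  "bent_pairs m n p q = {(x, y) \<in> sign_sequences m \<times> sign_sequences n.
     x p = y q \<and> card (extrema m n (bent_b x p q) (bent_l y p q)) = 4}"

lemma card_sign_sequences_turns_any:
  assumes "2 \<le> M"
  shows "card {x \<in> sign_sequences M. card (turns M x) = t} = 2 * ((M - 2) choose t)"
proof -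
  have "{x \<in> sign_sequences M. card (turns M x) = t} =
    {x \<in> sign_sequences M. x 1 = 1 \<and> card (turns M x) = t} \<union> {x \<in> sign_sequences M. x 1 = -1 \<and> card (turns M x) = t}"
    using sign_sequencesD[of _ M 1] assms by auto
  also have "card \<dots> = ((M - 2) choose t) + ((M - 2) choose t)"
    using card_sign_sequences_turns[OF assms, of 1 t] card_sign_sequences_turns[OF assms, of "-1" t]
    by (subst card_Un_disjoint) auto
  finally show ?thesis by simp
qed

text \<open>The first two terms pair one of the 2 walks without turns with a walk that turns twice.
  The last one places a single turn freely in each walk, with 2 ways to choose opposite initial
  signs.\<close>

lemma card_unbent_pairs:
  assumes "3 \<le> m" "3 \<le> n"
  shows "card (unbent_pairs m n) =
    4 * ((n - 2) choose 2) + 4 * ((m - 2) choose 2) + 2 * ((m - 2) * (n - 2))"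
proof -
  have mn: "2 \<le> m" "2 \<le> n" using assms by auto
  define S where "S M t = {x \<in> sign_sequences M. card (turns M x) = t}" for M t
  define R where "R M s = {x \<in> sign_sequences M. x 1 = s \<and> card (turns M x) = 1}" for M and s :: int
  have cS: "card (S M t) = 2 * ((M - 2) choose t)" if "2 \<le> M" for M t
    unfolding S_def by (rule card_sign_sequences_turns_any[OF that])
  have cR: "card (R M s) = M - 2" if "2 \<le> M" "s \<in> {1, -1}" for M s
    unfolding R_def using card_sign_sequences_turns[OF that, of 1] by simp
  have [simp]: "finite (S M t)" "finite (R M s)" for M t s
    by (simp_all add: S_def R_def)
  have "unbent_pairs m n = (S m 0 \<times> S n 2 \<union> S m 2 \<times> S n 0) \<union> (R m 1 \<times> R n (-1) \<union> R m (-1) \<times> R n 1)"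
  proof -
    have "card (extrema m n (\<lambda>i j. x i) (\<lambda>i j. y j)) = 4 \<longleftrightarrow>
      card (turns m x) = 0 \<and> card (turns n y) = 2 \<or> card (turns m x) = 2 \<and> card (turns n y) = 0 \<or>
      card (turns m x) = 1 \<and> card (turns n y) = 1 \<and> (x 1 = 1 \<and> y 1 = -1 \<or> x 1 = -1 \<and> y 1 = 1)"
      if "x \<in> sign_sequences m" "y \<in> sign_sequences n" for x y
    proof -
      have "x 1 = 1 \<or> x 1 = -1" "y 1 = 1 \<or> y 1 = -1"
        using sign_sequencesD[OF that(1), of 1] sign_sequencesD[OF that(2), of 1] mn by auto
      then have "x 1 \<noteq> y 1 \<longleftrightarrow> x 1 = 1 \<and> y 1 = -1 \<or> x 1 = -1 \<and> y 1 = 1" by auto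
      then show ?thesis
        unfolding card_extrema_unbent[OF mn(1)]
          unbent_count_eq_4_iff[OF mn sign_sequences_image[OF that(1)] sign_sequences_image[OF that(2)]]
        by blast
    qed
    then show ?thesis unfolding unbent_pairs_def S_def R_def by (intro set_eqI) (clarsimp, blast)
  qed
  also have "card \<dots> = (card (S m 0) * card (S n 2) + card (S m 2) * card (S n 0)) +
     (card (R m 1) * card (R n (-1)) + card (R m (-1)) * card (R n 1))"
    by (subst card_Un_disjoint, simp, simp, force simp: S_def R_def)+ (simp add: card_cartesian_product)
  also have "\<dots> = 4 * ((n - 2) choose 2) + 4 * ((m - 2) choose 2) + 2 * ((m - 2) * (n - 2))"
    using mn by (simp add: cS cR)
  finally show ?thesis .
qed

text \<open>The value \<open>a\<close> is never read if \<open>p = 1\<close>, nor is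
  \<open>c\<close> if \<open>p = M - 1\<close>. To keep the parameters unique, they are later
  required to equal \<open>s\<close> in these cases.\<close>

definition bend_sequence :: "nat \<Rightarrow> nat \<Rightarrow> int \<Rightarrow> int \<Rightarrow> int \<Rightarrow> nat \<Rightarrow> int" where
  "bend_sequence M p a s c = (\<lambda>i\<in>{1..<M}. if i < p then a else if i = p then s else c)"

lemma bend_sequence_simps:
  assumes "p \<in> {1..<M}"
  shows "bend_sequence M p a s c p = s"
    and "bend_sequence M p a s c 1 = (if p = 1 then s else a)"
    and "bend_sequence M p a s c (M - 1) = (if p = M - 1 then s else c)"
    and "one_bend M p (bend_sequence M p a s c)"
    and "a \<in> {1, -1} \<Longrightarrow> s \<in> {1, -1} \<Longrightarrow> c \<in> {1, -1} \<Longrightarrow> bend_sequence M p a s c \<in> sign_sequences M"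
  using assms by (auto simp: bend_sequence_def one_bend_def sign_sequences_def)

lemma bend_sequence_of_one_bend:
  assumes "x \<in> sign_sequences M" "one_bend M p x"
  shows "bend_sequence M p (x 1) (x p) (x (M - 1)) = x"
proof
  fix i
  have "x i = undefined" if "i \<notin> {1..<M}"
    using assms(1) that PiE_arb unfolding sign_sequences_def by metis
  moreover have "x i = x 1" if "i < p" "i \<in> {1..<M}"
  proof -
    have "i \<in> {1..<p}" using that by auto
    then show ?thesis using assms(2) unfolding one_bend_def by blast
  qed
  moreover have "x i = x (M - 1)" if "p < i" "i \<in> {1..<M}"
  proof -
    have "i \<in> {p<..<M}" using that by auto
    then show ?thesis using assms(2) unfolding one_bend_def by blast
  qed
  ultimately show "bend_sequence M p (x 1) (x p) (x (M - 1)) i = x i"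
    unfolding bend_sequence_def restrict_def by (metis linorder_neqE_nat)
qed

text \<open>Origin of 4, 8 and 6. The sign \<open>s\<close> is a factor 2. In the interior the four
  disjunctions form a cycle of implications through \<open>c\<close>, \<open>b\<close>,
  \<open>d\<close>, \<open>a\<close>: either value of \<open>c\<close> fixes the other three signs
  consistently. At a side one of these signs is fixed, and the two remaining disjunctions on the
  other three have 4 solutions. In a corner one disjunction on two free signs remains, with 3
  solutions.\<close>

lemma card_sign_quintuples:
  assumes "\<not> (e1 \<and> e2)" "\<not> (f1 \<and> f2)"
  shows "card {(s, a, b, c, d) \<in> {1, -1 :: int} \<times> {1, -1 :: int} \<times> {1, -1 :: int} \<times> {1, -1 :: int} \<times> {1, -1 :: int}.
      (e1 \<longrightarrow> a = s) \<and> (e2 \<longrightarrow> b = s) \<and> (f1 \<longrightarrow> c = s) \<and> (f2 \<longrightarrow> d = s) \<and>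
      (e1 \<or> f1 \<or> a = s \<or> c = s) \<and> (e2 \<or> f1 \<or> b = s \<or> c = - s) \<and>
      (e1 \<or> f2 \<or> a = - s \<or> d = s) \<and> (e2 \<or> f2 \<or> b = - s \<or> d = - s)} =
    (if e1 \<or> e2 then if f1 \<or> f2 then 6 else 8 else if f1 \<or> f2 then 8 else 4)"
    (is "card {(s, a, b, c, d) \<in> ?A. ?P s a b c d} = _")
proof -
  have two: "(\<Sum>s\<in>{1, -1 :: int}. h s) = h 1 + h (-1)" for h :: "int \<Rightarrow> nat" by simp
  have ind: "card {(s, a, b, c, d). (s, a, b, c, d) \<in> A \<and> R s a b c d} =
      (\<Sum>z\<in>A. of_bool (case z of (s, a, b, c, d) \<Rightarrow> R s a b c d))" if "finite A"
    for A :: "(int \<times> int \<times> int \<times> int \<times> int) set" and R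
  proof -
    have "{(s, a, b, c, d). (s, a, b, c, d) \<in> A \<and> R s a b c d} = A \<inter> {z. case z of (s, a, b, c, d) \<Rightarrow> R s a b c d}"
      by auto
    then show ?thesis using that by simp
  qed
  have "card {(s, a, b, c, d) \<in> ?A. ?P s a b c d} = (\<Sum>z\<in>?A. of_bool (case z of (s, a, b, c, d) \<Rightarrow> ?P s a b c d))"
    by (rule ind) simp
  also have "\<dots> = (\<Sum>s\<in>{1, -1}. \<Sum>a\<in>{1, -1}. \<Sum>b\<in>{1, -1}. \<Sum>c\<in>{1, -1}. \<Sum>d\<in>{1, -1}. of_bool (?P s a b c d))"
    by (simp only: sum.cartesian_product' case_prod_conv)
  also have "\<dots> = (if e1 \<or> e2 then if f1 \<or> f2 then 6 else 8 else if f1 \<or> f2 then 8 else 4)"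
    unfolding two using assms by (cases e1; cases e2; cases f1; cases f2) simp_all
  finally show ?thesis .
qed

lemma card_bent_pairs:
  assumes "3 \<le> m" "3 \<le> n" "p \<in> {1..<m}" "q \<in> {1..<n}"
  shows "card (bent_pairs m n p q) =
    (if p = 1 \<or> p = m - 1 then if q = 1 \<or> q = n - 1 then 6 else 8
     else if q = 1 \<or> q = n - 1 then 8 else 4)"
proof -
  let ?A = "{1, -1 :: int} \<times> {1, -1 :: int} \<times> {1, -1 :: int} \<times> {1, -1 :: int} \<times> {1, -1 :: int}"
  \<comment> \<open>The entries are the sign at the saddle, the two end steps of \<open>x\<close>
    and the two end steps of \<open>y\<close>. The first four implications make the encoding unique
    where an end step is the step at the saddle itself.\<close>
  define Q where "Q = {(s, a, b, c, d) \<in> ?A.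
      (p = 1 \<longrightarrow> a = s) \<and> (p = m - 1 \<longrightarrow> b = s) \<and> (q = 1 \<longrightarrow> c = s) \<and> (q = n - 1 \<longrightarrow> d = s) \<and>
      (p = 1 \<or> q = 1 \<or> a = s \<or> c = s) \<and> (p = m - 1 \<or> q = 1 \<or> b = s \<or> c = - s) \<and>
      (p = 1 \<or> q = n - 1 \<or> a = - s \<or> d = s) \<and> (p = m - 1 \<or> q = n - 1 \<or> b = - s \<or> d = - s)}"
  define f where "f = (\<lambda>(x :: nat \<Rightarrow> int, y :: nat \<Rightarrow> int). (x p, x 1, x (m - 1), y 1, y (n - 1)))"
  define g where "g = (\<lambda>(s, a, b, c, d). (bend_sequence m p a s b, bend_sequence n q c s d))"
  have pairs: "bent_pairs m n p q = {(x, y) \<in> sign_sequences m \<times> sign_sequences n. x p = y q \<and> bent_ok m n p q x y}"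
    unfolding bent_pairs_def
    using card_extrema_bent_eq_4[OF sign_sequences_image sign_sequences_image assms(3,4)] by auto
  have "bij_betw f (bent_pairs m n p q) Q"
  proof (rule bij_betw_byWitness[where f' = g])
    show "\<forall>z\<in>bent_pairs m n p q. g (f z) = z"
    proof
      fix z assume "z \<in> bent_pairs m n p q"
      then obtain x y where z: "z = (x, y)" "x \<in> sign_sequences m" "y \<in> sign_sequences n" "x p = y q"
        "one_bend m p x" "one_bend n q y"
        unfolding pairs bent_ok_def by blast
      then show "g (f z) = z"
        using bend_sequence_of_one_bend[of x m p] bend_sequence_of_one_bend[of y n q] by (simp add: f_def g_def)
    qed
    show "\<forall>z\<in>Q. f (g z) = z"
    proof
      fix z assume zQ: "z \<in> Q"
      obtain s a b c d where z: "z = (s, a, b, c, d)" by (cases z) auto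
      have "(p = 1 \<longrightarrow> a = s) \<and> (p = m - 1 \<longrightarrow> b = s) \<and> (q = 1 \<longrightarrow> c = s) \<and> (q = n - 1 \<longrightarrow> d = s)"
        using zQ unfolding z Q_def mem_Collect_eq case_prod_conv by - (elim conjE, intro conjI; assumption)
      then have "(if p = 1 then s else a) = a" "(if p = m - 1 then s else b) = b"
        "(if q = 1 then s else c) = c" "(if q = n - 1 then s else d) = d"
        by simp_all
      then show "f (g z) = z"
        unfolding z f_def g_def case_prod_conv bend_sequence_simps(1-3)[OF assms(3)]
          bend_sequence_simps(1-3)[OF assms(4)] by (simp only:)
    qed
    show "f ` bent_pairs m n p q \<subseteq> Q"
    proof
      fix w assume "w \<in> f ` bent_pairs m n p q"
      then obtain x y where w: "w = (x p, x 1, x (m - 1), y 1, y (n - 1))" and xy: "x \<in> sign_sequences m" "y \<in> sign_sequences n"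
        "x p = y q" and ok: "bent_ok m n p q x y"
        unfolding pairs f_def by auto
      have "x p \<in> {1, -1}" "x 1 \<in> {1, -1}" "x (m - 1) \<in> {1, -1}" "y 1 \<in> {1, -1}" "y (n - 1) \<in> {1, -1}"
        using sign_sequencesD[OF xy(1), of p] sign_sequencesD[OF xy(1), of 1] sign_sequencesD[OF xy(1), of "m - 1"]
          sign_sequencesD[OF xy(2), of 1] sign_sequencesD[OF xy(2), of "n - 1"] assms by auto
      moreover have "p = 1 \<longrightarrow> x 1 = x p" "p = m - 1 \<longrightarrow> x (m - 1) = x p" "q = 1 \<longrightarrow> y 1 = x p" "q = n - 1 \<longrightarrow> y (n - 1) = x p"
        using xy(3) by auto
      ultimately show "w \<in> Q"
        using ok unfolding w Q_def bent_ok_def mem_Collect_eq case_prod_conv mem_Times_iff fst_conv snd_conv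
        by - (elim conjE, intro conjI; assumption)
    qed
    show "g ` Q \<subseteq> bent_pairs m n p q"
    proof
      fix z assume "z \<in> g ` Q"
      then obtain s a b c d where z: "z = (bend_sequence m p a s b, bend_sequence n q c s d)" and Q: "(s, a, b, c, d) \<in> Q"
        unfolding g_def by auto
      have "s \<in> {1, -1} \<and> a \<in> {1, -1} \<and> b \<in> {1, -1} \<and> c \<in> {1, -1} \<and> d \<in> {1, -1}"
        using Q unfolding Q_def mem_Collect_eq case_prod_conv mem_Times_iff fst_conv snd_conv
        by - (elim conjE, intro conjI; assumption)
      then have sgn: "s \<in> {1, -1}" "a \<in> {1, -1}" "b \<in> {1, -1}" "c \<in> {1, -1}" "d \<in> {1, -1}"
        by blast+
      have C: "((p = 1 \<longrightarrow> a = s) \<and> (p = m - 1 \<longrightarrow> b = s) \<and> (q = 1 \<longrightarrow> c = s) \<and> (q = n - 1 \<longrightarrow> d = s)) \<and>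
        (p = 1 \<or> q = 1 \<or> a = s \<or> c = s) \<and> (p = m - 1 \<or> q = 1 \<or> b = s \<or> c = - s) \<and>
        (p = 1 \<or> q = n - 1 \<or> a = - s \<or> d = s) \<and> (p = m - 1 \<or> q = n - 1 \<or> b = - s \<or> d = - s)"
        using Q unfolding Q_def mem_Collect_eq case_prod_conv by - (elim conjE, intro conjI; assumption)
      then have ifs: "(if p = 1 then s else a) = a" "(if p = m - 1 then s else b) = b"
        "(if q = 1 then s else c) = c" "(if q = n - 1 then s else d) = d"
        by simp_all
      have "bent_ok m n p q (bend_sequence m p a s b) (bend_sequence n q c s d)"
        unfolding bent_ok_def bend_sequence_simps(1-3)[OF assms(3)] bend_sequence_simps(1-3)[OF assms(4)] ifs
        by (intro conjI bend_sequence_simps(4) assms(3,4) C[THEN conjunct2, THEN conjunct1]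
          C[THEN conjunct2, THEN conjunct2, THEN conjunct1]
          C[THEN conjunct2, THEN conjunct2, THEN conjunct2, THEN conjunct1]
          C[THEN conjunct2, THEN conjunct2, THEN conjunct2, THEN conjunct2])
      then show "z \<in> bent_pairs m n p q"
        unfolding pairs z using bend_sequence_simps(5)[OF assms(3) sgn(2,1,3)] bend_sequence_simps(5)[OF assms(4) sgn(4,1,5)]
        by (simp add: bend_sequence_simps(1)[OF assms(3)] bend_sequence_simps(1)[OF assms(4)])
    qed
  qed
  then have "card (bent_pairs m n p q) = card Q" by (rule bij_betw_same_card)
  also have "\<dots> = (if p = 1 \<or> p = m - 1 then if q = 1 \<or> q = n - 1 then 6 else 8 else if q = 1 \<or> q = n - 1 then 8 else 4)"
    unfolding Q_def using assms by (intro card_sign_quintuples) auto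
  finally show ?thesis .
qed

lemma sum_ends:
  fixes u v :: nat
  assumes "3 \<le> M"
  shows "(\<Sum>i\<in>{1..<M}. if i = 1 \<or> i = M - 1 then u else v) = 2 * u + (M - 3) * v"
proof -
  have "{1..<M} = insert 1 (insert (M - 1) {2..<M - 1})" using assms by auto
  moreover have "(\<Sum>i\<in>{2..<M - 1}. if i = 1 \<or> i = M - 1 then u else v) = (\<Sum>i\<in>{2..<M - 1}. v)"
    by (rule sum.cong) auto
  ultimately show ?thesis using assms by (simp add: numeral_3_eq_3)
qed

lemma sum_card_bent_pairs:
  assumes "3 \<le> m" "3 \<le> n"
  shows "(\<Sum>p\<in>{1..<m}. \<Sum>q\<in>{1..<n}. card (bent_pairs m n p q)) =
    2 * (12 + (n - 3) * 8) + (m - 3) * (16 + (n - 3) * 4)"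
proof -
  have "(\<Sum>p\<in>{1..<m}. \<Sum>q\<in>{1..<n}. card (bent_pairs m n p q)) =
    (\<Sum>p\<in>{1..<m}. if p = 1 \<or> p = m - 1 then 2 * 6 + (n - 3) * 8 else 2 * 8 + (n - 3) * 4)"
  proof (rule sum.cong[OF refl])
    fix p assume p: "p \<in> {1..<m}"
    have "(\<Sum>q\<in>{1..<n}. card (bent_pairs m n p q)) =
      (\<Sum>q\<in>{1..<n}. if q = 1 \<or> q = n - 1 then if p = 1 \<or> p = m - 1 then 6 else 8
         else if p = 1 \<or> p = m - 1 then 8 else 4)"
      by (rule sum.cong[OF refl], subst card_bent_pairs[OF assms p]) auto
    then show "(\<Sum>q\<in>{1..<n}. card (bent_pairs m n p q)) =
      (if p = 1 \<or> p = m - 1 then 2 * 6 + (n - 3) * 8 else 2 * 8 + (n - 3) * 4)"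
      unfolding sum_ends[OF assms(2)] by simp
  qed
  then show ?thesis unfolding sum_ends[OF assms(1)] by simp
qed

lemma total_count:
  assumes "3 \<le> m" "3 \<le> n"
  shows "int (card (unbent_pairs m n) + (\<Sum>p\<in>{1..<m}. \<Sum>q\<in>{1..<n}. card (bent_pairs m n p q))) =
    2 * (int m)^2 + 2 * (int n)^2 + 6 * int m * int n - 10 * (int m + int n) - 4"
proof -
  \<comment> \<open>The substitution removes the truncated subtractions, and the doubled binomial
    identity below avoids a division.\<close>
  obtain a c where mn: "m = a + 3" "n = c + 3"
    using assms by (metis add.commute le_Suc_ex)
  have ch: "2 * int ((k + 1) choose 2) = int k * (int k + 1)" for k
    by (induction k) (simp_all add: numeral_2_eq_2 algebra_simps)
  show ?thesis
    unfolding card_unbent_pairs[OF assms] sum_card_bent_pairs[OF assms]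
    using ch[of a] ch[of c] unfolding mn by (simp add: algebra_simps power2_eq_square)
qed

section \<open>Colourings as sign fields\<close>

lemma residue_cases: "(d :: 3) = 0 \<or> d = 1 \<or> d = 2"
proof (cases d)
  case (of_int z)
  then have "z = 0 \<or> z = 1 \<or> z = 2" by auto
  then show ?thesis using of_int(1) by auto
qed

text \<open>The three residues modulo 3 add up to 0, so the one that differs from \<open>a\<close>
  and \<open>b\<close> is \<open>- a - b\<close>.\<close>

lemma residue_third:
  fixes a b :: 3
  assumes "a \<noteq> b"
  shows "- a - b \<noteq> a" "- a - b \<noteq> b" "c \<noteq> a \<Longrightarrow> c \<noteq> b \<Longrightarrow> c = - a - b"
proof -
  have "- a - b \<noteq> a \<and> - a - b \<noteq> b \<and> (c \<noteq> a \<longrightarrow> c \<noteq> b \<longrightarrow> c = - a - b)"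
    using residue_cases[of a] residue_cases[of b] residue_cases[of c] assms by (elim disjE) simp_all
  then show "- a - b \<noteq> a" "- a - b \<noteq> b" "c \<noteq> a \<Longrightarrow> c \<noteq> b \<Longrightarrow> c = - a - b" by blast+
qed

text \<open>The representative 1 or -1 of a nonzero residue. The default -1 at residue 0 keeps
  \<open>residue_sign_range\<close> unconditional, so that steps are signs even off the
  grid.\<close>

definition residue_sign :: "3 \<Rightarrow> int" where
  "residue_sign d = (if d = 1 then 1 else -1)"

lemma residue_sign_range: "residue_sign d \<in> {1, -1}"
  by (simp add: residue_sign_def)

lemma of_int_residue_sign: "d \<noteq> 0 \<Longrightarrow> of_int (residue_sign d) = d"
  using residue_cases[of d] by (elim disjE) (simp_all add: residue_sign_def)

lemma residue_sign_of_int: "k \<in> {1, -1} \<Longrightarrow> residue_sign (of_int k) = k"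
  by (elim insertE emptyE) (simp_all add: residue_sign_def)

lemma residue_sign_eq:
  fixes a b :: 3
  assumes "a \<noteq> b"
  shows "residue_sign (b - a) = 1 \<longleftrightarrow> b = a + 1" "residue_sign (b - a) = -1 \<longleftrightarrow> b = a + 2"
    "residue_sign (b - a) = -1 \<longleftrightarrow> a = b + 1" "residue_sign (b - a) = 1 \<longleftrightarrow> a = b + 2"
  using residue_cases[of a] residue_cases[of b] assms
  by (elim disjE; simp add: residue_sign_def)+

text \<open>Both sums lie in {-2, 0, 2}, whose members are distinct modulo 3. This is what lifts the
  relation around a unit square from residues to integers.\<close>

lemma residue_sign_sum:
  fixes a b c d :: int
  assumes "a \<in> {1, -1}" "b \<in> {1, -1}" "c \<in> {1, -1}" "d \<in> {1, -1}"
    and "(of_int a + of_int b :: 3) = of_int c + of_int d"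
  shows "a + b = c + d"
  using assms by (elim insertE emptyE) simp_all

definition hstep :: "(nat \<times> nat \<Rightarrow> 3) \<Rightarrow> nat \<Rightarrow> nat \<Rightarrow> int" where
  "hstep c i j = residue_sign (c (i + 1, j) - c (i, j))"

definition vstep :: "(nat \<times> nat \<Rightarrow> 3) \<Rightarrow> nat \<Rightarrow> nat \<Rightarrow> int" where
  "vstep c i j = residue_sign (c (i, j + 1) - c (i, j))"

definition flippable :: "nat \<Rightarrow> nat \<Rightarrow> (nat \<times> nat \<Rightarrow> 3) \<Rightarrow> (nat \<times> nat) set" where
  "flippable m n c = {v \<in> grid_vertices m n. \<forall>u w. grid_adj m n v u \<longrightarrow> grid_adj m n v w \<longrightarrow> c u = c w}"

lemma grid_adj_sym: "grid_adj m n u v \<longleftrightarrow> grid_adj m n v u"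
  by (auto simp: grid_adj_def)

lemma grid_adj_right: "i \<in> {1..<m} \<Longrightarrow> j \<in> {1..n} \<Longrightarrow> grid_adj m n (i, j) (i + 1, j)"
  and grid_adj_up: "i \<in> {1..m} \<Longrightarrow> j \<in> {1..<n} \<Longrightarrow> grid_adj m n (i, j) (i, j + 1)"
  by (auto simp: grid_adj_def grid_vertices_def)

lemma grid_adj_all:
  assumes "i \<in> {1..m}" "j \<in> {1..n}"
  shows "(\<forall>u. grid_adj m n (i, j) u \<longrightarrow> P u) \<longleftrightarrow>
    (i < m \<longrightarrow> P (i + 1, j)) \<and> (1 < i \<longrightarrow> P (i - 1, j)) \<and> (j < n \<longrightarrow> P (i, j + 1)) \<and> (1 < j \<longrightarrow> P (i, j - 1))"
    (is "?L \<longleftrightarrow> ?R")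
proof
  assume L: ?L
  have "i < m \<Longrightarrow> grid_adj m n (i, j) (i + 1, j)" "1 < i \<Longrightarrow> grid_adj m n (i, j) (i - 1, j)"
    "j < n \<Longrightarrow> grid_adj m n (i, j) (i, j + 1)" "1 < j \<Longrightarrow> grid_adj m n (i, j) (i, j - 1)"
    using assms by (auto simp: grid_adj_def grid_vertices_def)
  then show ?R using L by blast
next
  assume R: ?R
  show ?L
  proof (intro allI impI)
    fix u assume u: "grid_adj m n (i, j) u"
    obtain a b where ab: "u = (a, b)" by (cases u)
    have "i < m \<and> u = (i + 1, j) \<or> 1 < i \<and> u = (i - 1, j) \<or> j < n \<and> u = (i, j + 1) \<or> 1 < j \<and> u = (i, j - 1)"
      using u unfolding ab grid_adj_def grid_vertices_def by auto
    then show "P u" using R by blast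
  qed
qed

lemma proper_neq: "c \<in> proper_colourings m n \<Longrightarrow> grid_adj m n u v \<Longrightarrow> c u \<noteq> c v"
  unfolding proper_colourings_def by blast

lemma proper_step:
  assumes "c \<in> proper_colourings m n"
  shows "i \<in> {1..<m} \<Longrightarrow> j \<in> {1..n} \<Longrightarrow> c (i + 1, j) = c (i, j) + of_int (hstep c i j)"
    and "i \<in> {1..m} \<Longrightarrow> j \<in> {1..<n} \<Longrightarrow> c (i, j + 1) = c (i, j) + of_int (vstep c i j)"
proof -
  assume "i \<in> {1..<m}" "j \<in> {1..n}"
  from proper_neq[OF assms grid_adj_right[OF this]]
  show "c (i + 1, j) = c (i, j) + of_int (hstep c i j)"
    unfolding hstep_def by (subst of_int_residue_sign) auto
next
  assume "i \<in> {1..m}" "j \<in> {1..<n}"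
  from proper_neq[OF assms grid_adj_up[OF this]]
  show "c (i, j + 1) = c (i, j) + of_int (vstep c i j)"
    unfolding vstep_def by (subst of_int_residue_sign) auto
qed

lemma sign_field_proper:
  assumes "2 \<le> m" "2 \<le> n" "c \<in> proper_colourings m n"
  shows "sign_field m n (hstep c) (vstep c)"
proof
  show "2 \<le> m" "2 \<le> n" by fact+
  show "hstep c i j \<in> {1, -1}" "vstep c i j \<in> {1, -1}" for i j
    unfolding hstep_def vstep_def by (rule residue_sign_range)+
  fix i j assume ij: "i \<in> {1..<m}" "j \<in> {1..<n}"
  have "c (i, j) + (of_int (hstep c i j) + of_int (vstep c (i + 1) j)) =
        c (i, j) + (of_int (vstep c i j) + of_int (hstep c i (j + 1)))"
    using proper_step(1)[OF assms(3), of i j] proper_step(2)[OF assms(3), of "i + 1" j]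
      proper_step(2)[OF assms(3), of i j] proper_step(1)[OF assms(3), of i "j + 1"] ij
    by (simp add: add.assoc)
  then show "hstep c i j + vstep c (i + 1) j = vstep c i j + hstep c i (j + 1)"
    by (intro residue_sign_sum) (simp_all only: hstep_def vstep_def residue_sign_range add_left_cancel)
qed

text \<open>A common colour of the neighbours differs from \<open>c (i, j)\<close>, so it is
  \<open>c (i, j) + 1\<close> or \<open>c (i, j) + 2\<close>. In the first case all steps away from
  the vertex rise and it is a minimum; in the second they fall and it is a maximum.\<close>

lemma flippable_eq_extrema:
  assumes "2 \<le> m" "2 \<le> n" "c \<in> proper_colourings m n"
  shows "flippable m n c = extrema m n (hstep c) (vstep c)"
proof -
  have key: "(i, j) \<in> flippable m n c \<longleftrightarrow> (i, j) \<in> extrema m n (hstep c) (vstep c)"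
    if ij: "i \<in> {1..m}" "j \<in> {1..n}" for i j
  proof -
    have ne: "i < m \<Longrightarrow> c (i, j) \<noteq> c (i + 1, j)" "1 < i \<Longrightarrow> c (i - 1, j) \<noteq> c (i, j)"
      "j < n \<Longrightarrow> c (i, j) \<noteq> c (i, j + 1)" "1 < j \<Longrightarrow> c (i, j - 1) \<noteq> c (i, j)"
      using proper_neq[OF assms(3) grid_adj_right[of i m j n]] proper_neq[OF assms(3) grid_adj_right[of "i - 1" m j n]]
        proper_neq[OF assms(3) grid_adj_up[of i m j n]] proper_neq[OF assms(3) grid_adj_up[of i m "j - 1" n]] ij
      by (force+)
    have e: "hstep c i j = 1 \<longleftrightarrow> c (i + 1, j) = c (i, j) + 1" "hstep c i j = -1 \<longleftrightarrow> c (i + 1, j) = c (i, j) + 2" if "i < m"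
      using residue_sign_eq[OF ne(1)[OF that]] by (simp_all only: hstep_def)
    have w: "hstep c (i - 1) j = -1 \<longleftrightarrow> c (i - 1, j) = c (i, j) + 1" "hstep c (i - 1) j = 1 \<longleftrightarrow> c (i - 1, j) = c (i, j) + 2" if "1 < i"
      using residue_sign_eq[OF ne(2)[OF that]] that by (simp_all add: hstep_def)
    have u: "vstep c i j = 1 \<longleftrightarrow> c (i, j + 1) = c (i, j) + 1" "vstep c i j = -1 \<longleftrightarrow> c (i, j + 1) = c (i, j) + 2" if "j < n"
      using residue_sign_eq[OF ne(3)[OF that]] by (simp_all only: vstep_def)
    have d: "vstep c i (j - 1) = -1 \<longleftrightarrow> c (i, j - 1) = c (i, j) + 1" "vstep c i (j - 1) = 1 \<longleftrightarrow> c (i, j - 1) = c (i, j) + 2" if "1 < j"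
      using residue_sign_eq[OF ne(4)[OF that]] that by (simp_all add: vstep_def)
    have mins: "i \<in> minima m (\<lambda>i. hstep c i j) \<and> j \<in> minima n (vstep c i) \<longleftrightarrow>
        (\<forall>v. grid_adj m n (i, j) v \<longrightarrow> c v = c (i, j) + 1)"
      unfolding grid_adj_all[OF ij] minima_def mem_Collect_eq using ij e(1) w(1) u(1) d(1) by blast
    have maxs: "i \<in> maxima m (\<lambda>i. hstep c i j) \<and> j \<in> maxima n (vstep c i) \<longleftrightarrow>
        (\<forall>v. grid_adj m n (i, j) v \<longrightarrow> c v = c (i, j) + 2)"
      unfolding grid_adj_all[OF ij] maxima_def mem_Collect_eq using ij e(2) w(2) u(2) d(2) by blast
    \<comment> \<open>An actual neighbour is fixed in order to name the common colour; one exists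
      because \<open>m\<close> is at least 2.\<close>
    obtain v where v: "grid_adj m n (i, j) v"
    proof (cases "i < m")
      case True
      then show thesis using that grid_adj_right[of i m j n] ij by auto
    next
      case False
      then show thesis using that[of "(i - 1, j)"] ij assms(1) by (auto simp: grid_adj_def grid_vertices_def)
    qed
    have "c v \<noteq> c (i, j)" using proper_neq[OF assms(3) v] by simp
    then have cv: "c v = c (i, j) + 1 \<or> c v = c (i, j) + 2"
      using residue_cases[of "c v - c (i, j)"] by (auto simp: algebra_simps)
    have "(i, j) \<in> grid_vertices m n" using ij by (simp add: grid_vertices_def)
    then have "(i, j) \<in> flippable m n c \<longleftrightarrow>
        (\<forall>u w. grid_adj m n (i, j) u \<longrightarrow> grid_adj m n (i, j) w \<longrightarrow> c u = c w)"
      by (simp only: flippable_def mem_Collect_eq simp_thms)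
    also have "\<dots> \<longleftrightarrow> (\<forall>u. grid_adj m n (i, j) u \<longrightarrow> c u = c (i, j) + 1) \<or>
        (\<forall>u. grid_adj m n (i, j) u \<longrightarrow> c u = c (i, j) + 2)" (is "?A \<longleftrightarrow> ?B")
    proof
      assume A: ?A
      then have "\<forall>u. grid_adj m n (i, j) u \<longrightarrow> c u = c v" using v by blast
      then show ?B using cv by (elim disjE) simp_all
    next
      assume ?B
      then show ?A by (elim disjE) simp_all
    qed
    finally show ?thesis unfolding mins[symmetric] maxs[symmetric] extrema_def by simp
  qed
  have "flippable m n c \<subseteq> {1..m} \<times> {1..n}" by (auto simp: flippable_def grid_vertices_def)
  then show ?thesis using key extrema_subset[of m n "hstep c" "vstep c"] by blast
qed

section \<open>Degrees in the flip graph\<close>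

lemma proper_colouringsI:
  assumes "c \<in> extensional (grid_vertices m n)" "\<And>u v. grid_adj m n u v \<Longrightarrow> c u \<noteq> c v"
  shows "c \<in> proper_colourings m n"
  using assms by (simp add: proper_colourings_def PiE_def)

lemma proper_extensional: "c \<in> proper_colourings m n \<Longrightarrow> c \<in> extensional (grid_vertices m n)"
  by (auto simp: proper_colourings_def PiE_def)

lemma rotate_apply: "v \<in> grid_vertices m n \<Longrightarrow> rotate_colouring m n k c v = c v + k"
  by (simp add: rotate_colouring_def)

lemma rotate_extensional: "rotate_colouring m n k c \<in> extensional (grid_vertices m n)"
  by (simp add: rotate_colouring_def)

lemma rotate_0: "c \<in> extensional (grid_vertices m n) \<Longrightarrow> rotate_colouring m n 0 c = c"
  by (simp add: rotate_colouring_def extensional_restrict)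

lemma rotate_rotate: "rotate_colouring m n k (rotate_colouring m n k' c) = rotate_colouring m n (k' + k) c"
  by (auto simp: rotate_colouring_def fun_eq_iff add.assoc)

lemma rotate_proper:
  assumes "c \<in> proper_colourings m n"
  shows "rotate_colouring m n k c \<in> proper_colourings m n"
proof (rule proper_colouringsI[OF rotate_extensional])
  fix u v assume uv: "grid_adj m n u v"
  then have "u \<in> grid_vertices m n" "v \<in> grid_vertices m n" by (simp_all add: grid_adj_def)
  then show "rotate_colouring m n k c u \<noteq> rotate_colouring m n k c v"
    using proper_neq[OF assms uv] by (simp add: rotate_apply)
qed

lemma orbit_rotate: "colouring_orbit m n (rotate_colouring m n k c) = colouring_orbit m n c"
proof -
  have "\<exists>k''. rotate_colouring m n k' c = rotate_colouring m n (k + k'') c" for k'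
    by (rule exI[of _ "k' - k"]) simp
  then show ?thesis unfolding colouring_orbit_def rotate_rotate by blast
qed

lemma orbit_self: "c \<in> proper_colourings m n \<Longrightarrow> c \<in> colouring_orbit m n c"
  unfolding colouring_orbit_def using rotate_0[OF proper_extensional] by (metis (mono_tags, lifting) mem_Collect_eq)

lemma orbit_eq_imp_rotate:
  assumes "c \<in> proper_colourings m n" "colouring_orbit m n c = colouring_orbit m n d"
  obtains k where "c = rotate_colouring m n k d"
proof -
  have "c \<in> colouring_orbit m n d" using orbit_self[OF assms(1)] assms(2) by simp
  then show thesis using that unfolding colouring_orbit_def by blast
qed

text \<open>At a flippable vertex all neighbours have the same colour, so the choice of u does not matter.\<close>

definition flip_vertex :: "nat \<Rightarrow> nat \<Rightarrow> (nat \<times> nat \<Rightarrow> 3) \<Rightarrow> nat \<times> nat \<Rightarrow> (nat \<times> nat \<Rightarrow> 3)" where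
  "flip_vertex m n c v = c(v := - c v - c (SOME u. grid_adj m n v u))"

lemma grid_has_neighbour:
  assumes "2 \<le> m" "v \<in> grid_vertices m n"
  shows "\<exists>u. grid_adj m n v u"
proof -
  obtain i j where v: "v = (i, j)" by (cases v)
  have "grid_adj m n v (i + 1, j) \<or> grid_adj m n v (i - 1, j)"
    using assms by (auto simp: v grid_adj_def grid_vertices_def)
  then show ?thesis by blast
qed

text \<open>A vertex that two flips leave untouched forces a rotation between their results to be
  0.\<close>

lemma grid_third_vertex:
  assumes "2 \<le> m" "2 \<le> n"
  obtains u where "u \<in> grid_vertices m n" "u \<noteq> v" "u \<noteq> w"
proof -
  have "(1, 1) \<in> grid_vertices m n" "(1, 2) \<in> grid_vertices m n" "(2, 1) \<in> grid_vertices m n"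
    using assms by (simp_all add: grid_vertices_def)
  moreover have "(1, 1) \<noteq> v \<and> (1, 1) \<noteq> w \<or> (1, 2) \<noteq> v \<and> (1, 2) \<noteq> w \<or> (2, 1) \<noteq> v \<and> (2, 1) \<noteq> w"
    by (cases v; cases w) auto
  ultimately show thesis using that by blast
qed

lemma flip_vertex_other: "u \<noteq> v \<Longrightarrow> flip_vertex m n c v u = c u"
  by (simp add: flip_vertex_def)

lemma flip_vertex_same:
  assumes "v \<in> flippable m n c" "grid_adj m n v u"
  shows "flip_vertex m n c v v = - c v - c u"
proof -
  have "grid_adj m n v (SOME u. grid_adj m n v u)" using assms(2) by (rule someI)
  then have "c (SOME u. grid_adj m n v u) = c u"
    using assms unfolding flippable_def by blast
  then show ?thesis by (simp add: flip_vertex_def)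
qed

lemma flip_vertex_proper:
  assumes "2 \<le> m" "c \<in> proper_colourings m n" "v \<in> flippable m n c"
  shows "flip_vertex m n c v \<in> proper_colourings m n" "flip_vertex m n c v v \<noteq> c v"
proof -
  have v: "v \<in> grid_vertices m n" using assms(3) by (simp add: flippable_def)
  have irr: "\<not> grid_adj m n u u" for u by (auto simp: grid_adj_def)
  have nb: "flip_vertex m n c v v \<noteq> c u \<and> flip_vertex m n c v v \<noteq> c v" if u: "grid_adj m n v u" for u
    unfolding flip_vertex_same[OF assms(3) u]
    using residue_third(1,2)[OF proper_neq[OF assms(2) u]] by blast
  show "flip_vertex m n c v v \<noteq> c v" using nb grid_has_neighbour[OF assms(1) v] by blast
  show "flip_vertex m n c v \<in> proper_colourings m n"
  proof (rule proper_colouringsI)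
    show "flip_vertex m n c v \<in> extensional (grid_vertices m n)"
      using proper_extensional[OF assms(2)] v by (auto simp: flip_vertex_def extensional_def)
    fix u w assume uw: "grid_adj m n u w"
    then have wu: "grid_adj m n w u" by (simp add: grid_adj_sym)
    consider "u = v" "w \<noteq> v" | "w = v" "u \<noteq> v" | "u \<noteq> v" "w \<noteq> v" using uw irr by blast
    then show "flip_vertex m n c v u \<noteq> flip_vertex m n c v w"
    proof cases
      case 1
      then show ?thesis using nb[of w] uw by (simp add: flip_vertex_other)
    next
      case 2
      then show ?thesis using nb[of u] wu by (metis flip_vertex_other)
    next
      case 3
      then show ?thesis using proper_neq[OF assms(2) uw] by (simp add: flip_vertex_other)
    qed
  qed
qed

text \<open>The neighbours of an orbit are the orbits of the flipped colourings, and distinct flips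
  give distinct orbits: a vertex untouched by both excludes every nonzero rotation.\<close>

lemma OFG_degree_eq:
  assumes "2 \<le> m" "2 \<le> n" "c \<in> proper_colourings m n"
  shows "OFG_degree m n (colouring_orbit m n c) = card (flippable m n c)"
proof -
  note flip = flip_vertex_proper[OF assms(1,3)]
  let ?o = "colouring_orbit m n"
  have grid: "v \<in> grid_vertices m n" if "v \<in> flippable m n c" for v
    using that by (simp add: flippable_def)
  have "inj_on (\<lambda>v. ?o (flip_vertex m n c v)) (flippable m n c)"
  proof (rule inj_onI, rule ccontr)
    fix v w assume v: "v \<in> flippable m n c" and w: "w \<in> flippable m n c"
      and eq: "?o (flip_vertex m n c v) = ?o (flip_vertex m n c w)" and "v \<noteq> w"
    obtain k where k: "flip_vertex m n c v = rotate_colouring m n k (flip_vertex m n c w)"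
      using orbit_eq_imp_rotate[OF flip(1)[OF v] eq] .
    obtain u where u: "u \<in> grid_vertices m n" "u \<noteq> v" "u \<noteq> w" using grid_third_vertex[OF assms(1,2)] .
    have "c u = c u + k"
      using fun_cong[OF k, of u] u by (simp add: rotate_apply flip_vertex_other)
    then have "k = 0" by simp
    then have "flip_vertex m n c v v = c v"
      using fun_cong[OF k, of v] grid[OF v] \<open>v \<noteq> w\<close> by (simp add: rotate_apply flip_vertex_other)
    then show False using flip(2)[OF v] by simp
  qed
  moreover have "{Y. OFG_adj m n (?o c) Y} = (\<lambda>v. ?o (flip_vertex m n c v)) ` flippable m n c"
  proof (intro equalityI subsetI)
    fix Y assume "Y \<in> (\<lambda>v. ?o (flip_vertex m n c v)) ` flippable m n c"
    then obtain v where v: "v \<in> flippable m n c" and Y: "Y = ?o (flip_vertex m n c v)" by blast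
    have "?o c \<noteq> Y"
    proof
      assume "?o c = Y"
      then obtain k where k: "c = rotate_colouring m n k (flip_vertex m n c v)"
        using orbit_eq_imp_rotate[OF assms(3)] unfolding Y by blast
      obtain u where u: "u \<in> grid_vertices m n" "u \<noteq> v" using grid_third_vertex[OF assms(1,2), of v v] .
      have "c u = c u + k" using fun_cong[OF k, of u] u by (simp add: rotate_apply flip_vertex_other)
      then have "c v = flip_vertex m n c v v" using fun_cong[OF k, of v] grid[OF v] by (simp add: rotate_apply)
      then show False using flip(2)[OF v] by simp
    qed
    moreover have "\<exists>!u. u \<in> grid_vertices m n \<and> c u \<noteq> flip_vertex m n c v u"
      using grid[OF v] flip(2)[OF v] flip_vertex_other[of _ v m n c] by metis
    ultimately have "OFG_adj m n (?o c) Y"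
      unfolding OFG_adj_def OFG_vertices_def Y
      using assms(3) flip(1)[OF v] orbit_self[OF assms(3)] orbit_self[OF flip(1)[OF v]] by blast
    then show "Y \<in> {Y. OFG_adj m n (?o c) Y}" by simp
  next
    fix Y assume "Y \<in> {Y. OFG_adj m n (?o c) Y}"
    then obtain c1 d1 where c1: "c1 \<in> ?o c" and d1: "d1 \<in> Y" and Y: "Y \<in> OFG_vertices m n"
      and ex1: "\<exists>!v. v \<in> grid_vertices m n \<and> c1 v \<noteq> d1 v"
      by (auto simp: OFG_adj_def)
    obtain k where k: "c1 = rotate_colouring m n k c" using c1 by (auto simp: colouring_orbit_def)
    obtain d0 k0 where d0: "d0 \<in> proper_colourings m n" "Y = ?o d0" and k0: "d1 = rotate_colouring m n k0 d0"
      using Y d1 by (auto simp: OFG_vertices_def colouring_orbit_def)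
    \<comment> \<open>Rotating back replaces the two representatives by a pair that starts with
      \<open>c\<close> itself and differs at the same single vertex.\<close>
    define d where "d = rotate_colouring m n (- k) d1"
    have dp: "d \<in> proper_colourings m n" unfolding d_def k0 by (intro rotate_proper d0)
    have dY: "Y = ?o d" unfolding d_def k0 orbit_rotate by (rule d0(2))
    have diff: "c u \<noteq> d u \<longleftrightarrow> c1 u \<noteq> d1 u" if "u \<in> grid_vertices m n" for u
    proof -
      have "c1 u = c u + k" "d1 u = d u + k" using that by (simp_all add: k d_def rotate_apply)
      then show ?thesis by simp
    qed
    obtain v where v1: "v \<in> grid_vertices m n" "c1 v \<noteq> d1 v"
      and un: "\<And>u. u \<in> grid_vertices m n \<and> c1 u \<noteq> d1 u \<Longrightarrow> u = v"
      using ex1 by (elim ex1E) blast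
    then have v: "v \<in> grid_vertices m n" "c v \<noteq> d v" using diff by blast+
    have others: "c u = d u" if "u \<in> grid_vertices m n" "u \<noteq> v" for u
      using un[of u] diff[of u] that by blast
    \<comment> \<open>The neighbour has the same colour in \<open>c\<close> and \<open>d\<close>,
      and that colour avoids the distinct colours \<open>c v\<close> and \<open>d v\<close>; so it
      is the third residue.\<close>
    have nb: "c u = - c v - d v" if u: "grid_adj m n v u" for u
    proof -
      have "u \<in> grid_vertices m n" "u \<noteq> v" using u by (auto simp: grid_adj_def)
      then have "c u = d u" by (rule others)
      then show ?thesis
        using residue_third(3)[OF v(2), of "c u"] proper_neq[OF assms(3) u] proper_neq[OF dp u] by simp
    qed
    have "c u = c w" if "grid_adj m n v u" "grid_adj m n v w" for u w
      unfolding nb[OF that(1)] nb[OF that(2)] ..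
    then have vF: "v \<in> flippable m n c" unfolding flippable_def using v(1) by blast
    obtain u where u: "grid_adj m n v u" using grid_has_neighbour[OF assms(1) v(1)] by blast
    have "flip_vertex m n c v = d"
    proof
      fix w
      consider "w = v" | "w \<noteq> v" "w \<in> grid_vertices m n" | "w \<noteq> v" "w \<notin> grid_vertices m n" by blast
      then show "flip_vertex m n c v w = d w"
      proof cases
        case 1
        then show ?thesis using flip_vertex_same[OF vF u] nb[OF u] by simp
      next
        case 2
        then show ?thesis using others by (simp add: flip_vertex_other)
      next
        case 3
        then show ?thesis
          using extensional_arb[OF proper_extensional[OF assms(3)] 3(2)] extensional_arb[OF proper_extensional[OF dp] 3(2)]
          by (simp add: flip_vertex_other)
      qed
    qed
    then show "Y \<in> (\<lambda>v. ?o (flip_vertex m n c v)) ` flippable m n c" using vF dY by blast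
  qed
  ultimately show ?thesis by (simp add: OFG_degree_def card_image)
qed

section \<open>Normalised representatives of the orbits\<close>

definition normalised :: "nat \<Rightarrow> nat \<Rightarrow> (nat \<times> nat \<Rightarrow> 3) set" where
  "normalised m n = {c \<in> proper_colourings m n. c (1, 1) = 0}"

lemma card_OFG_degree:
  assumes "2 \<le> m" "2 \<le> n"
  shows "card {X \<in> OFG_vertices m n. OFG_degree m n X = k} =
    card {c \<in> normalised m n. card (extrema m n (hstep c) (vstep c)) = k}"
proof -
  have one: "(1, 1) \<in> grid_vertices m n" using assms by (simp add: grid_vertices_def)
  have deg: "OFG_degree m n (colouring_orbit m n c) = card (extrema m n (hstep c) (vstep c))"
    if "c \<in> proper_colourings m n" for c
    unfolding OFG_degree_eq[OF assms that] flippable_eq_extrema[OF assms that] ..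
  have "{X \<in> OFG_vertices m n. OFG_degree m n X = k} =
    colouring_orbit m n ` {c \<in> normalised m n. card (extrema m n (hstep c) (vstep c)) = k}"
  proof (intro equalityI subsetI)
    fix X assume "X \<in> {X \<in> OFG_vertices m n. OFG_degree m n X = k}"
    then obtain c where c: "c \<in> proper_colourings m n" "X = colouring_orbit m n c" "OFG_degree m n X = k"
      by (auto simp: OFG_vertices_def)
    define d where "d = rotate_colouring m n (- c (1, 1)) c"
    have d: "d \<in> proper_colourings m n" "X = colouring_orbit m n d" "d (1, 1) = 0"
      using rotate_proper[OF c(1)] c(2) one by (simp_all add: d_def orbit_rotate rotate_apply)
    then have "d \<in> {c \<in> normalised m n. card (extrema m n (hstep c) (vstep c)) = k}"
      using c(3) deg[OF d(1)] by (simp add: normalised_def)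
    then show "X \<in> colouring_orbit m n ` {c \<in> normalised m n. card (extrema m n (hstep c) (vstep c)) = k}"
      using d(2) by blast
  next
    fix X assume "X \<in> colouring_orbit m n ` {c \<in> normalised m n. card (extrema m n (hstep c) (vstep c)) = k}"
    then show "X \<in> {X \<in> OFG_vertices m n. OFG_degree m n X = k}"
      using deg by (auto simp: normalised_def OFG_vertices_def)
  qed
  moreover have "inj_on (colouring_orbit m n) {c \<in> normalised m n. card (extrema m n (hstep c) (vstep c)) = k}"
  proof (rule inj_onI)
    fix c d assume "c \<in> {c \<in> normalised m n. card (extrema m n (hstep c) (vstep c)) = k}"
      "d \<in> {c \<in> normalised m n. card (extrema m n (hstep c) (vstep c)) = k}"
      and eq: "colouring_orbit m n c = colouring_orbit m n d"
    then have c: "c \<in> proper_colourings m n" "c (1, 1) = 0" and d: "d \<in> proper_colourings m n" "d (1, 1) = 0"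
      by (auto simp: normalised_def)
    obtain r where r: "c = rotate_colouring m n r d" using orbit_eq_imp_rotate[OF c(1) eq] .
    have "r = 0" using fun_cong[OF r, of "(1, 1)"] c(2) d(2) one by (simp add: rotate_apply)
    then show "c = d" using r rotate_0[OF proper_extensional[OF d(1)]] by simp
  qed
  ultimately show ?thesis by (simp add: card_image)
qed

section \<open>Colourings with at most one saddle\<close>

text \<open>The index pair (m, n) lies outside the range of saddles and encodes that there is none.\<close>

definition saddle_index :: "nat \<Rightarrow> nat \<Rightarrow> nat \<Rightarrow> nat \<Rightarrow> bool" where
  "saddle_index m n p q \<longleftrightarrow> p \<in> {1..<m} \<and> q \<in> {1..<n} \<or> p = m \<and> q = n"

text \<open>Steps are transported from the bottom row and the left column, and only the square
  \<open>(p, q)\<close> can reverse one. For the index \<open>(m, n)\<close> neither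
  \<open>i = p\<close> nor \<open>j = q\<close> occurs among the steps concerned, so the transport
  is plain.\<close>

lemma (in sign_field) bent_of_saddles:
  assumes Sad: "Sad = {(p, q)} \<inter> ({1..<m} \<times> {1..<n})" and pq: "saddle_index m n p q"
  shows "i \<in> {1..<m} \<Longrightarrow> j \<in> {1..n} \<Longrightarrow> b i j = bent_b (\<lambda>i. b i 1) p q i j"
    and "i \<in> {1..m} \<Longrightarrow> j \<in> {1..<n} \<Longrightarrow> l i j = bent_l (l 1) p q i j"
proof -
  assume ij: "i \<in> {1..<m}" "j \<in> {1..n}"
  show "b i j = bent_b (\<lambda>i. b i 1) p q i j"
  proof (cases "i = p \<and> q < j")
    case True
    then have S: "(p, q) \<in> Sad" and q: "q \<in> {1..<n}" using Sad pq ij by (auto simp: saddle_index_def)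
    have "b p q = b p 1" by (rule b_const) (use Sad True ij q in auto)
    moreover have "b p j = b p (q + 1)" by (rule b_const) (use Sad True ij q in auto)
    ultimately show ?thesis using True saddle_signs(2)[OF S] by (simp add: bent_b_def)
  next
    case False
    then have "b i j = b i 1" by (intro b_const) (use Sad ij in auto)
    then show ?thesis using False by (auto simp: bent_b_def)
  qed
next
  assume ij: "i \<in> {1..m}" "j \<in> {1..<n}"
  show "l i j = bent_l (l 1) p q i j"
  proof (cases "j = q \<and> p < i")
    case True
    then have S: "(p, q) \<in> Sad" and p: "p \<in> {1..<m}" using Sad pq ij by (auto simp: saddle_index_def)
    have "l p q = l 1 q" by (rule l_const) (use Sad True ij p in auto)
    moreover have "l i q = l (p + 1) q" by (rule l_const) (use Sad True ij p in auto)
    ultimately show ?thesis using True saddle_signs[OF S] by (simp add: bent_l_def)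
  next
    case False
    then have "l i j = l 1 j" by (intro l_const) (use Sad ij in auto)
    then show ?thesis using False by (auto simp: bent_l_def)
  qed
qed

text \<open>The height modulo 3, obtained by climbing the left column to row j and then following
  that row. For q < j the row contains step \<open>p\<close> with the sign reversed, which changes
  the sum by \<open>- 2 * x p\<close> once p < i.\<close>

definition bent_colouring ::
  "nat \<Rightarrow> nat \<Rightarrow> nat \<Rightarrow> nat \<Rightarrow> (nat \<Rightarrow> int) \<Rightarrow> (nat \<Rightarrow> int) \<Rightarrow> (nat \<times> nat \<Rightarrow> 3)" where
  "bent_colouring m n p q x y = (\<lambda>(i, j)\<in>grid_vertices m n.
     of_int ((\<Sum>k\<in>{1..<i}. x k) + (\<Sum>k\<in>{1..<j}. y k) - (if p < i \<and> q < j then 2 * x p else 0)))"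

lemma bent_range:
  assumes "x \<in> sign_sequences M" "i \<in> {1..<M}"
  shows "bent_b x p q i j \<in> {1, -1}" "bent_l x p q j i \<in> {1, -1}"
  using sign_sequencesD[OF assms] by (auto simp: bent_b_def bent_l_def)

lemma bent_colouring_step:
  assumes "x \<in> sign_sequences m" "y \<in> sign_sequences n" "saddle_index m n p q" "p < m \<longrightarrow> x p = y q"
  shows "i \<in> {1..<m} \<Longrightarrow> j \<in> {1..n} \<Longrightarrow> bent_colouring m n p q x y (i + 1, j) =
      bent_colouring m n p q x y (i, j) + of_int (bent_b x p q i j)"
    and "i \<in> {1..m} \<Longrightarrow> j \<in> {1..<n} \<Longrightarrow> bent_colouring m n p q x y (i, j + 1) =
      bent_colouring m n p q x y (i, j) + of_int (bent_l y p q i j)"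
proof -
  assume ij: "i \<in> {1..<m}" "j \<in> {1..n}"
  then have "(i, j) \<in> grid_vertices m n" "(i + 1, j) \<in> grid_vertices m n"
    by (auto simp: grid_vertices_def)
  moreover have "(\<Sum>k\<in>{1..<i + 1}. x k) = (\<Sum>k\<in>{1..<i}. x k) + x i" using ij by simp
  ultimately show "bent_colouring m n p q x y (i + 1, j) =
      bent_colouring m n p q x y (i, j) + of_int (bent_b x p q i j)"
    unfolding bent_colouring_def by (auto simp: bent_b_def less_Suc_eq)
next
  assume ij: "i \<in> {1..m}" "j \<in> {1..<n}"
  then have "(i, j) \<in> grid_vertices m n" "(i, j + 1) \<in> grid_vertices m n"
    by (auto simp: grid_vertices_def)
  moreover have "(\<Sum>k\<in>{1..<j + 1}. y k) = (\<Sum>k\<in>{1..<j}. y k) + y j" using ij by simp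
  \<comment> \<open>The correction is written with \<open>x p\<close>, but the vertical step
    reverses \<open>y q\<close>. The two agree at an actual saddle, and for the index
    \<open>(m, n)\<close> the premise p < i is impossible.\<close>
  moreover have "p < i \<Longrightarrow> x p = y q" using assms(3,4) ij by (auto simp: saddle_index_def)
  ultimately show "bent_colouring m n p q x y (i, j + 1) =
      bent_colouring m n p q x y (i, j) + of_int (bent_l y p q i j)"
    unfolding bent_colouring_def by (auto simp: bent_l_def less_Suc_eq)
qed

lemma of_int_sign_nonzero: "k \<in> {1, -1} \<Longrightarrow> (of_int k :: 3) \<noteq> 0"
  by auto

lemma bent_colouring_props:
  assumes "2 \<le> m" "2 \<le> n"
    and "x \<in> sign_sequences m" "y \<in> sign_sequences n" "saddle_index m n p q" "p < m \<longrightarrow> x p = y q"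
  defines "c \<equiv> bent_colouring m n p q x y"
  shows "c \<in> normalised m n"
    and "\<And>i j. i \<in> {1..<m} \<Longrightarrow> j \<in> {1..n} \<Longrightarrow> hstep c i j = bent_b x p q i j"
    and "\<And>i j. i \<in> {1..m} \<Longrightarrow> j \<in> {1..<n} \<Longrightarrow> vstep c i j = bent_l y p q i j"
    and "saddles m n (hstep c) = {(p, q)} \<inter> ({1..<m} \<times> {1..<n})"
proof -
  note step = bent_colouring_step[OF assms(3-6), folded c_def]
  have h: "hstep c i j = bent_b x p q i j" if "i \<in> {1..<m}" "j \<in> {1..n}" for i j
    unfolding hstep_def step(1)[OF that] add_diff_cancel_left'
    by (rule residue_sign_of_int[OF bent_range(1)[OF assms(3) that(1)]])
  have v: "vstep c i j = bent_l y p q i j" if "i \<in> {1..m}" "j \<in> {1..<n}" for i j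
    unfolding vstep_def step(2)[OF that] add_diff_cancel_left'
    by (rule residue_sign_of_int[OF bent_range(2)[OF assms(4) that(2)]])
  show "\<And>i j. i \<in> {1..<m} \<Longrightarrow> j \<in> {1..n} \<Longrightarrow> hstep c i j = bent_b x p q i j"
    "\<And>i j. i \<in> {1..m} \<Longrightarrow> j \<in> {1..<n} \<Longrightarrow> vstep c i j = bent_l y p q i j"
    by (fact h, fact v)
  have hn: "c (i + 1, j) \<noteq> c (i, j)" if "i \<in> {1..<m}" "j \<in> {1..n}" for i j
    unfolding step(1)[OF that] using of_int_sign_nonzero[OF bent_range(1)[OF assms(3) that(1)]] by simp
  have vn: "c (i, j + 1) \<noteq> c (i, j)" if "i \<in> {1..m}" "j \<in> {1..<n}" for i j
    unfolding step(2)[OF that] using of_int_sign_nonzero[OF bent_range(2)[OF assms(4) that(2)]] by simp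
  have "c \<in> proper_colourings m n"
  proof (rule proper_colouringsI)
    show "c \<in> extensional (grid_vertices m n)" by (simp add: c_def bent_colouring_def)
    fix u v assume uv: "grid_adj m n u v"
    obtain i j i' j' where ij: "u = (i, j)" "v = (i', j')" by (cases u; cases v)
    from uv consider "i' = i" "j' = j + 1" "i \<in> {1..m}" "j \<in> {1..<n}" | "i' = i" "j = j' + 1" "i \<in> {1..m}" "j' \<in> {1..<n}"
      | "j' = j" "i' = i + 1" "i \<in> {1..<m}" "j \<in> {1..n}" | "j' = j" "i = i' + 1" "i' \<in> {1..<m}" "j \<in> {1..n}"
      unfolding ij grid_adj_def grid_vertices_def by auto
    then show "c u \<noteq> c v"
      unfolding ij using hn vn by cases metis+
  qed
  moreover have "c (1, 1) = 0"
    using assms(1,2,5) by (auto simp: c_def bent_colouring_def grid_vertices_def saddle_index_def)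
  ultimately show "c \<in> normalised m n" by (simp add: normalised_def)
  have mem: "(i, j) \<in> saddles m n (hstep c) \<longleftrightarrow> (i, j) = (p, q)" if "i \<in> {1..<m}" "j \<in> {1..<n}" for i j
  proof -
    have "j \<in> {1..n}" "j + 1 \<in> {1..n}" using that by auto
    then have "(i, j) \<in> saddles m n (hstep c) \<longleftrightarrow> bent_b x p q i j \<noteq> bent_b x p q i (j + 1)"
      using that h by (simp add: saddles_def)
    moreover have "x i \<noteq> - x i" using sign_sequencesD[OF assms(3) that(1)] by auto
    ultimately show ?thesis by (auto simp: bent_b_def)
  qed
  show "saddles m n (hstep c) = {(p, q)} \<inter> ({1..<m} \<times> {1..<n})"
  proof (rule set_eqI)
    fix z :: "nat \<times> nat"
    obtain i j where z: "z = (i, j)" by (cases z)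
    have "z \<in> saddles m n (hstep c) \<Longrightarrow> i \<in> {1..<m} \<and> j \<in> {1..<n}" by (simp add: z saddles_def)
    then show "z \<in> saddles m n (hstep c) \<longleftrightarrow> z \<in> {(p, q)} \<inter> ({1..<m} \<times> {1..<n})"
      using mem[of i j] unfolding z by blast
  qed
qed

lemma normalised_eqI:
  assumes "c \<in> normalised m n" "d \<in> normalised m n"
    and "\<And>i j. i \<in> {1..<m} \<Longrightarrow> j \<in> {1..n} \<Longrightarrow> hstep c i j = hstep d i j"
    and "\<And>i j. i \<in> {1..m} \<Longrightarrow> j \<in> {1..<n} \<Longrightarrow> vstep c i j = vstep d i j"
  shows "c = d"
proof
  fix v :: "nat \<times> nat"
  have cd: "c \<in> proper_colourings m n" "d \<in> proper_colourings m n" "c (1, 1) = d (1, 1)"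
    using assms(1,2) by (simp_all add: normalised_def)
  obtain i j where v: "v = (i, j)" by (cases v)
  show "c v = d v"
  proof (cases "v \<in> grid_vertices m n")
    case True
    then have ij: "1 \<le> i" "i \<le> m" "1 \<le> j" "j \<le> n" by (auto simp: v grid_vertices_def)
    have "c (i, 1) = d (i, 1)"
      using ij(1,2)
    proof (induction i rule: dec_induct)
      case (step k)
      then show ?case
        using proper_step(1)[OF cd(1), of k 1] proper_step(1)[OF cd(2), of k 1] assms(3)[of k 1] ij by simp
    qed (use cd(3) in simp)
    with ij(3,4) show ?thesis unfolding v
    proof (induction j rule: dec_induct)
      case (step k)
      then show ?case
        using proper_step(2)[OF cd(1), of i k] proper_step(2)[OF cd(2), of i k] assms(4)[of i k] ij by simp
    qed simp
  next
    case False
    from extensional_arb[OF proper_extensional[OF cd(1)] this] extensional_arb[OF proper_extensional[OF cd(2)] this]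
    show ?thesis by simp
  qed
qed

definition colourings_with_saddle :: "nat \<Rightarrow> nat \<Rightarrow> nat \<Rightarrow> nat \<Rightarrow> (nat \<times> nat \<Rightarrow> 3) set" where
  "colourings_with_saddle m n p q = {c \<in> normalised m n.
     card (extrema m n (hstep c) (vstep c)) = 4 \<and> saddles m n (hstep c) = {(p, q)} \<inter> ({1..<m} \<times> {1..<n})}"

text \<open>A normalised colouring with prescribed saddle is determined by its bottom row and left
  column, and any two sign sequences extend to one if they agree at the saddle. The guard
  \<open>p < m\<close> lifts that proviso for the index \<open>(m, n)\<close>, so that one proof
  covers the cases with and without a saddle.\<close>

lemma card_colourings_with_saddle:
  assumes mn: "2 \<le> m" "2 \<le> n" and pq: "saddle_index m n p q"
  shows "card (colourings_with_saddle m n p q) =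
    card {(x, y) \<in> sign_sequences m \<times> sign_sequences n.
      (p < m \<longrightarrow> x p = y q) \<and> card (extrema m n (bent_b x p q) (bent_l y p q)) = 4}"
    (is "card ?C = card ?P")
proof -
  define f where "f c = (\<lambda>i\<in>{1..<m}. hstep c i 1, \<lambda>j\<in>{1..<n}. vstep c 1 j)" for c
  define g where "g = (\<lambda>(x, y). bent_colouring m n p q x y)"
  have pq1: "1 \<le> p" "1 \<le> q" using pq mn by (auto simp: saddle_index_def)
  have f_props: "f c = (x, y) \<Longrightarrow> x \<in> sign_sequences m \<and> y \<in> sign_sequences n \<and> (p < m \<longrightarrow> x p = y q) \<and>
      (\<forall>i\<in>{1..<m}. \<forall>j\<in>{1..n}. hstep c i j = bent_b x p q i j) \<and>
      (\<forall>i\<in>{1..m}. \<forall>j\<in>{1..<n}. vstep c i j = bent_l y p q i j)"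
    if c: "c \<in> ?C" for c x y
  proof -
    assume fc: "f c = (x, y)"
    have x: "x i = hstep c i 1" if "i \<in> {1..<m}" for i using fc that by (auto simp: f_def)
    have y: "y j = vstep c 1 j" if "j \<in> {1..<n}" for j using fc that by (auto simp: f_def)
    have c: "c \<in> proper_colourings m n" "saddles m n (hstep c) = {(p, q)} \<inter> ({1..<m} \<times> {1..<n})"
      using c by (auto simp: colourings_with_saddle_def normalised_def)
    interpret sign_field m n "hstep c" "vstep c" by (rule sign_field_proper[OF mn c(1)])
    have h: "hstep c i j = bent_b x p q i j" if "i \<in> {1..<m}" "j \<in> {1..n}" for i j
      using bent_of_saddles(1)[OF c(2) pq that] by (simp only: bent_b_def x[OF that(1)])
    have v: "vstep c i j = bent_l y p q i j" if "i \<in> {1..m}" "j \<in> {1..<n}" for i j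
      using bent_of_saddles(2)[OF c(2) pq that] by (simp only: bent_l_def y[OF that(2)])
    have "x p = y q" if "p < m"
    proof -
      have r: "p \<in> {1..<m}" "q \<in> {1..<n}" using pq that by (auto simp: saddle_index_def)
      then have "(p, q) \<in> saddles m n (hstep c)" using c(2) by auto
      from saddle_signs(1)[OF this] show ?thesis
        using h[of p q] v[of p q] r by (simp add: bent_b_def bent_l_def)
    qed
    moreover have "x = (\<lambda>i\<in>{1..<m}. hstep c i 1)" "y = (\<lambda>j\<in>{1..<n}. vstep c 1 j)" using fc by (auto simp: f_def)
    then have "x \<in> sign_sequences m" "y \<in> sign_sequences n"
      using residue_sign_range by (auto simp: sign_sequences_def hstep_def vstep_def)
    ultimately show ?thesis using h v by blast
  qed
  have g_props: "g (x, y) \<in> ?C \<and> f (g (x, y)) = (x, y)" if xy: "(x, y) \<in> ?P" for x y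
  proof -
    have x: "x \<in> sign_sequences m" and y: "y \<in> sign_sequences n" and e: "p < m \<longrightarrow> x p = y q"
      and four: "card (extrema m n (bent_b x p q) (bent_l y p q)) = 4" using xy by auto
    note props = bent_colouring_props[OF mn x y pq e]
    have "extrema m n (hstep (g (x, y))) (vstep (g (x, y))) = extrema m n (bent_b x p q) (bent_l y p q)"
      unfolding g_def case_prod_conv by (rule extrema_cong) (fact props(2), fact props(3))
    then have "g (x, y) \<in> ?C"
      using props(1,4) four by (simp add: colourings_with_saddle_def g_def)
    moreover have "f (g (x, y)) = (x, y)"
    proof -
      have "(\<lambda>i\<in>{1..<m}. hstep (g (x, y)) i 1) = x"
      proof
        fix i
        show "(\<lambda>i\<in>{1..<m}. hstep (g (x, y)) i 1) i = x i"
        proof (cases "i \<in> {1..<m}")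
          case True
          then show ?thesis using props(2)[of i 1] mn pq1 by (simp add: g_def bent_b_def)
        next
          case False
          then have "x i = undefined" using x PiE_arb unfolding sign_sequences_def by metis
          then show ?thesis using False by auto
        qed
      qed
      moreover have "(\<lambda>j\<in>{1..<n}. vstep (g (x, y)) 1 j) = y"
      proof
        fix j
        show "(\<lambda>j\<in>{1..<n}. vstep (g (x, y)) 1 j) j = y j"
        proof (cases "j \<in> {1..<n}")
          case True
          then show ?thesis using props(3)[of 1 j] mn pq1 by (simp add: g_def bent_l_def)
        next
          case False
          then have "y j = undefined" using y PiE_arb unfolding sign_sequences_def by metis
          then show ?thesis using False by auto
        qed
      qed
      ultimately show ?thesis by (simp add: f_def)
    qed
    ultimately show ?thesis by blast
  qed
  have "bij_betw f ?C ?P"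
  proof (rule bij_betw_byWitness[where f' = g])
    show "\<forall>c\<in>?C. g (f c) = c"
    proof
      fix c assume c: "c \<in> ?C"
      obtain x y where fc: "f c = (x, y)" by (cases "f c")
      note p = f_props[OF c fc]
      then have x: "x \<in> sign_sequences m" and y: "y \<in> sign_sequences n" and e: "p < m \<longrightarrow> x p = y q" by blast+
      note props = bent_colouring_props[OF mn x y pq e]
      show "g (f c) = c"
        unfolding fc g_def case_prod_conv
      proof (rule normalised_eqI[OF props(1)])
        show "c \<in> normalised m n" using c by (simp add: colourings_with_saddle_def)
      qed (use p props(2,3) in simp_all)
    qed
    show "\<forall>z\<in>?P. f (g z) = z" using g_props by blast
    show "f ` ?C \<subseteq> ?P"
    proof
      fix z assume "z \<in> f ` ?C"
      then obtain c where c: "c \<in> ?C" "z = f c" by blast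
      obtain x y where fc: "f c = (x, y)" by (cases "f c")
      note p = f_props[OF c(1) fc]
      have "extrema m n (hstep c) (vstep c) = extrema m n (bent_b x p q) (bent_l y p q)"
        by (rule extrema_cong) (use p in blast)+
      moreover have "card (extrema m n (hstep c) (vstep c)) = 4" using c(1) by (simp add: colourings_with_saddle_def)
      ultimately show "z \<in> ?P" unfolding c(2) fc using p by simp
    qed
    show "g ` ?P \<subseteq> ?C" using g_props by blast
  qed
  then show ?thesis by (rule bij_betw_same_card)
qed

theorem theorem3p9:
  fixes m n :: nat
  assumes "min m n \<ge> 3"
  shows "int (card {X \<in> OFG_vertices m n. OFG_degree m n X = 4}) =
           2 * (int m)^2 + 2 * (int n)^2 + 6 * int m * int n - 10 * (int m + int n) - 4"
proof -
  have mn3: "3 \<le> m" "3 \<le> n" and mn: "2 \<le> m" "2 \<le> n" using assms by auto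
  define N where "N = {c \<in> normalised m n. card (extrema m n (hstep c) (vstep c)) = 4}"
  define R where "R = {1..<m} \<times> {1..<n}"
  define D where "D = (\<lambda>(p, q). colourings_with_saddle m n p q)"
  have Sad: "saddles m n (hstep c) \<subseteq> R" for c by (auto simp: saddles_def R_def)
  have finR: "finite R" "(m, n) \<notin> R" by (auto simp: R_def)
  have split: "N = (\<Union>z\<in>insert (m, n) R. D z)"
  proof (intro equalityI subsetI)
    fix c assume c: "c \<in> N"
    then have "c \<in> proper_colourings m n" by (simp add: N_def normalised_def)
    then interpret sign_field m n "hstep c" "vstep c" by (rule sign_field_proper[OF mn])
    have "card (saddles m n (hstep c)) \<le> 1"
    proof (cases "saddles m n (hstep c) = {}")
      case False
      from card_saddles_extrema[OF this] show ?thesis using c by (simp add: N_def)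
    qed simp
    then consider "saddles m n (hstep c) = {}" | z where "saddles m n (hstep c) = {z}"
      by (metis card_0_eq card_1_singletonE finite_saddles le_less_trans less_one linorder_not_less nat_less_le)
    then show "c \<in> (\<Union>z\<in>insert (m, n) R. D z)"
    proof cases
      case 1
      then have "c \<in> D (m, n)" using c by (simp add: D_def N_def colourings_with_saddle_def)
      then show ?thesis by blast
    next
      case 2
      then have "z \<in> R" using Sad[of c] by blast
      then have "c \<in> D z" using 2 c by (cases z) (simp add: D_def N_def colourings_with_saddle_def R_def)
      then show ?thesis using \<open>z \<in> R\<close> by blast
    qed
  next
    fix c assume "c \<in> (\<Union>z\<in>insert (m, n) R. D z)"
    then show "c \<in> N" by (auto simp: D_def N_def colourings_with_saddle_def)
  qed
  have disj: "D z \<inter> D z' = {}" if "z \<in> insert (m, n) R" "z' \<in> insert (m, n) R" "z \<noteq> z'" for z z'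
  proof -
    have ne: "{z} \<inter> R \<noteq> {z'} \<inter> R"
    proof
      assume eq: "{z} \<inter> R = {z'} \<inter> R"
      have "z \<in> R \<or> z' \<in> R" using that by auto
      then have "z \<in> {z'} \<inter> R \<or> z' \<in> {z} \<inter> R" using eq by auto
      then show False using that(3) by auto
    qed
    have mem: "saddles m n (hstep c) = {z} \<inter> R" if "c \<in> D z" for c z
      using that by (cases z) (simp add: D_def colourings_with_saddle_def R_def)
    show ?thesis
    proof (rule equals0I)
      fix c assume "c \<in> D z \<inter> D z'"
      then show False using mem[of c z] mem[of c z'] ne by simp
    qed
  qed
  have fin: "finite (D z)" for z
  proof -
    have "proper_colourings m n \<subseteq> grid_vertices m n \<rightarrow>\<^sub>E (UNIV :: 3 set)" by (auto simp: proper_colourings_def)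
    then have "finite (proper_colourings m n)"
      by (rule finite_subset) (auto simp: grid_vertices_def intro!: finite_PiE)
    then show ?thesis
      by (rule finite_subset[rotated]) (cases z, auto simp: D_def colourings_with_saddle_def normalised_def)
  qed
  have "card N = (\<Sum>z\<in>insert (m, n) R. card (D z))"
    unfolding split by (rule card_UN_disjoint) (use finR fin disj in auto)
  also have "\<dots> = card (D (m, n)) + (\<Sum>z\<in>R. card (D z))" using finR by simp
  also have "card (D (m, n)) = card (unbent_pairs m n)"
  proof -
    have "extrema m n (bent_b x m n) (bent_l y m n) = extrema m n (\<lambda>i j. x i) (\<lambda>i j. y j)" for x y
      by (rule extrema_cong) (auto simp: bent_b_def bent_l_def)
    then show ?thesis
      unfolding D_def case_prod_conv unbent_pairs_def using card_colourings_with_saddle[OF mn, of m n]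
      by (simp add: saddle_index_def)
  qed
  also have "(\<Sum>z\<in>R. card (D z)) = (\<Sum>p\<in>{1..<m}. \<Sum>q\<in>{1..<n}. card (D (p, q)))"
    unfolding R_def by (simp add: sum.cartesian_product')
  also have "\<dots> = (\<Sum>p\<in>{1..<m}. \<Sum>q\<in>{1..<n}. card (bent_pairs m n p q))"
  proof (intro sum.cong refl)
    fix p q assume pq: "p \<in> {1..<m}" "q \<in> {1..<n}"
    then show "card (D (p, q)) = card (bent_pairs m n p q)"
      unfolding D_def case_prod_conv bent_pairs_def using card_colourings_with_saddle[OF mn, of p q]
      by (simp add: saddle_index_def)
  qed
  finally have "card N = card (unbent_pairs m n) + (\<Sum>p\<in>{1..<m}. \<Sum>q\<in>{1..<n}. card (bent_pairs m n p q))" .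
  then show ?thesis
    unfolding card_OFG_degree[OF mn] N_def[symmetric] using total_count[OF mn3] by simp
qed

end
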